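(* Let $R>0$, let $N\ge1$ be an integer, and let $0<T<R$. Suppose that $f\colon\mathbb{R}^N\to\mathbb{R}^N$ is of class $C^1$ and $\|Df(x)\|=O(|x|^\alpha)$ as $|x|\to\infty$ for some $\alpha\ge1$. For each $(\phi,r)\in\mathcal{L}^{\alpha+1}([-R,0],\mathbb{R}^N)\times[T,R]$, define a linear map $$B_{\phi,r}\colon\mathcal{L}^{\alpha+1}([-R,0],\mathbb{R}^N)\to C([-R,T],\mathbb{R}^N)$$ by $$B_{\phi,r}\chi(t)=\begin{cases}0 & (t\in[-R,0]),\\ \int_0^t Df(\phi(s-r))\chi(s-r)\,ds & (t\in[0,T]).\end{cases}$$ Then $B_{\phi,r}$ is a bounded linear operator, and for all $\phi,\phi_0\in\mathcal{L}^{\alpha+1}([-R,0],\mathbb{R}^N)$ and $r\in[T,R]$, $$\|B_{\phi,r}-B_{\phi_0,r}\|\le\|Df\circ\phi-Df\circ\phi_0\|_{L^q[-R,0]},$$ where $q$ is the Hölder conjugate of $\alpha+1$. Furthermore, for each such $(\phi,r)$, $$\|y(\cdot;\phi+\chi,r)-y(\cdot;\phi,r)-B_{\phi,r}\chi\|_{C[-R,T]}=o(\|\chi\|_{L^{\alpha+1}[-R,0]})$$ as $\|\chi\|_{L^{\alpha+1}[-R,0]}\to0$, where $y(\cdot;\phi,r)$ is defined by $x(\cdot;\phi,r)=y(\cdot;\phi,r)+\bar\phi$, with $x(\cdot;\phi,r)$ the solution of $\dot x(t)=f(x(t-r))$ $(t\ge0)$, $x(t)=\phi(t)$ $(t\in[-R,0])$,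 and $\bar\phi$ the static prolongation of $\phi$.
   Context: $|\cdot|$ is a fixed norm on $\mathbb{R}^N$, and $\|Df(x)\|$ is the corresponding operator norm of the real $N\times N$ matrix $Df(x)$. $\mathcal{L}^p([a,b],\mathbb{R}^N)$ ($1\le p<\infty$) is the linear space of Lebesgue measurable functions $\phi\colon[a,b]\to\mathbb{R}^N$ (actual functions, not equivalence classes) with $\int_a^b|\phi|^p<\infty$, endowed with the seminorm $\|\phi\|_{L^p[a,b]}=(\int_a^b|\phi(\theta)|^p\,d\theta)^{1/p}$; the same notation $\|\cdot\|_{L^q[a,b]}$ is used for matrix-valued functions with the matrix norm. $C([a,b],\mathbb{R}^N)$ carries the supremum norm $\|\cdot\|_{C[a,b]}$. A linear map $B$ between seminormed spaces is bounded if $\|B\chi\|\le C\|\chi\|$ for some $C$ and all $\chi$; $\|B\|$ is the infimum of such $C\ge 0$. The Hölder conjugate $q$ of $p$ satisfies $1/p+1/q=1$. Static prolongation: for $\phi\colon[-R,0]\to\mathbb{R}^N$, $\bar\phi\colon[-R,\infty)\to\mathbb{R}^N$ is given by $\bar\phi(t)=\phi(t)$ for $t\in[-R,0]$ and $\bar\phi(t)=\phi(0)$ for $t\ge0$. Solution: $x(\cdot;\phi,r)\colon[-R,\infty)\to\mathbb{R}^N$ is the unique function which equals $\phi$ on $[-R,0]$, is continuous on $[0,\infty)$, and satisfies $x(t)=\phi(0)+\int_0^t f(x(s-r))\,ds$ for all $t\ge0$ (constructed by the method of steps; on $[0,r]$ it equals $\phi(0)+\int_0^t f(\phi(s-r))\,ds$).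 $\|Df(x)\|=O(|x|^\alpha)$ as $|x|\to\infty$ means that there are $C,K>0$ with $\|Df(x)\|\le C|x|^\alpha$ whenever $|x|\ge K$. *)

theory Defs
  imports "HOL-Analysis.Analysis"
begin

text \<open>The type class norm of \<^typ>\<open>real ^ 'n\<close> is the Euclidean one. The norm on
  \<open>R^N\<close> considered here is arbitrary, so it is carried as an explicit parameter.\<close>

definition is_norm :: "(real ^ 'n \<Rightarrow> real) \<Rightarrow> bool" where
  "is_norm nrm \<longleftrightarrow>
     (\<forall>v. 0 \<le> nrm v) \<and>
     (\<forall>v. nrm v = 0 \<longleftrightarrow> v = 0) \<and>
     (\<forall>c v. nrm (c *\<^sub>R v) = \<bar>c\<bar> * nrm v) \<and>
     (\<forall>v w. nrm (v + w) \<le> nrm v + nrm w)"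

text \<open>\<open>V\<close> is the (carrier of the) domain; \<open>p\<close> and \<open>q\<close> are the seminorms of the
  domain and of the codomain.\<close>

definition bounded_map :: "'a set \<Rightarrow> ('a \<Rightarrow> real) \<Rightarrow> ('b \<Rightarrow> real) \<Rightarrow> ('a \<Rightarrow> 'b) \<Rightarrow> bool" where
  "bounded_map V p q B \<longleftrightarrow> (\<exists>C. \<forall>v\<in>V. q (B v) \<le> C * p v)"

definition op_norm :: "'a set \<Rightarrow> ('a \<Rightarrow> real) \<Rightarrow> ('b \<Rightarrow> real) \<Rightarrow> ('a \<Rightarrow> 'b) \<Rightarrow> real" where
  "op_norm V p q B = Inf {C. 0 \<le> C \<and> (\<forall>v\<in>V. q (B v) \<le> C * p v)}"

definition mat_norm :: "(real ^ 'n \<Rightarrow> real) \<Rightarrow> real ^ 'n ^ 'n \<Rightarrow> real" where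
  "mat_norm nrm A = op_norm UNIV nrm nrm (\<lambda>v. A *v v)"

abbreviation Df :: "(real ^ 'n \<Rightarrow> real ^ 'n) \<Rightarrow> real ^ 'n \<Rightarrow> real ^ 'n ^ 'n" where
  "Df f x \<equiv> jacobian f (at x)"

definition class_C1 :: "(real ^ 'n \<Rightarrow> real ^ 'n) \<Rightarrow> bool" where
  "class_C1 f \<longleftrightarrow> (\<forall>x. f differentiable (at x)) \<and> continuous_on UNIV (Df f)"

text \<open>Functions on \<open>[a,b]\<close> are represented by total functions whose values outside
  \<open>[a,b]\<close> are irrelevant. The first argument of \<open>Lp_norm\<close> is the norm of the value
  space, so that it also applies to matrix-valued functions.\<close>

definition Lp :: "(real ^ 'n \<Rightarrow> real) \<Rightarrow> real \<Rightarrow> real \<Rightarrow> real \<Rightarrow> (real \<Rightarrow> real ^ 'n) set" where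
  "Lp nrm p a b = {\<phi>. \<phi> \<in> borel_measurable (lebesgue_on {a..b}) \<and>
                       integrable (lebesgue_on {a..b}) (\<lambda>\<theta>. nrm (\<phi> \<theta>) powr p)}"

definition Lp_norm :: "('v \<Rightarrow> real) \<Rightarrow> real \<Rightarrow> real \<Rightarrow> real \<Rightarrow> (real \<Rightarrow> 'v) \<Rightarrow> real" where
  "Lp_norm nrm p a b \<phi> = (LINT \<theta>|lebesgue_on {a..b}. nrm (\<phi> \<theta>) powr p) powr (1 / p)"

definition C_norm :: "('v \<Rightarrow> real) \<Rightarrow> real \<Rightarrow> real \<Rightarrow> (real \<Rightarrow> 'v) \<Rightarrow> real" where
  "C_norm nrm a b g = (SUP t\<in>{a..b}. nrm (g t))"

definition prolongation :: "(real \<Rightarrow> real ^ 'n) \<Rightarrow> real \<Rightarrow> real ^ 'n" where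
  "prolongation \<phi> t = (if t \<le> 0 then \<phi> t else \<phi> 0)"

definition is_solution ::
    "real \<Rightarrow> (real ^ 'n \<Rightarrow> real ^ 'n) \<Rightarrow> (real \<Rightarrow> real ^ 'n) \<Rightarrow> real \<Rightarrow> (real \<Rightarrow> real ^ 'n) \<Rightarrow> bool" where
  "is_solution R f \<phi> r x \<longleftrightarrow>
     (\<forall>t\<in>{-R..0}. x t = \<phi> t) \<and>
     continuous_on {0..} x \<and>
     (\<forall>t\<ge>0. integrable (lebesgue_on {0..t}) (\<lambda>s. f (x (s - r))) \<and>
             x t = \<phi> 0 + (LINT s|lebesgue_on {0..t}. f (x (s - r))))"

text \<open>Membership in \<open>extensional {-R..}\<close> makes functions on \<open>[-R,\<infinity>)\<close> correspond
  one-to-one to total functions, as the definite description requires.\<close>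

definition solution ::
    "real \<Rightarrow> (real ^ 'n \<Rightarrow> real ^ 'n) \<Rightarrow> (real \<Rightarrow> real ^ 'n) \<Rightarrow> real \<Rightarrow> real \<Rightarrow> real ^ 'n" where
  "solution R f \<phi> r = (THE x. x \<in> extensional {-R..} \<and> is_solution R f \<phi> r x)"

definition y_part ::
    "real \<Rightarrow> (real ^ 'n \<Rightarrow> real ^ 'n) \<Rightarrow> (real \<Rightarrow> real ^ 'n) \<Rightarrow> real \<Rightarrow> real \<Rightarrow> real ^ 'n" where
  "y_part R f \<phi> r t = solution R f \<phi> r t - prolongation \<phi> t"

definition B_op ::
    "(real ^ 'n \<Rightarrow> real ^ 'n) \<Rightarrow> (real \<Rightarrow> real ^ 'n) \<Rightarrow> real \<Rightarrow> (real \<Rightarrow> real ^ 'n) \<Rightarrow> real \<Rightarrow> real ^ 'n" where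
  "B_op f \<phi> r \<eta> t =
     (if t \<le> 0 then 0 else (LINT s|lebesgue_on {0..t}. Df f (\<phi> (s - r)) *v \<eta> (s - r)))"

text \<open>Linearity is an identity between elements of \<open>C([c,d])\<close>, hence only
  required pointwise on \<open>[c,d]\<close>.\<close>

definition bounded_linear_Lp_C ::
    "(real ^ 'n \<Rightarrow> real) \<Rightarrow> real \<Rightarrow> real \<Rightarrow> real \<Rightarrow> real \<Rightarrow> real \<Rightarrow>
     ((real \<Rightarrow> real ^ 'n) \<Rightarrow> real \<Rightarrow> real ^ 'n) \<Rightarrow> bool" where
  "bounded_linear_Lp_C nrm p a b c d B \<longleftrightarrow>
     (\<forall>\<eta>\<in>Lp nrm p a b. continuous_on {c..d} (B \<eta>)) \<and>
     (\<forall>\<eta>\<in>Lp nrm p a b. \<forall>\<psi>\<in>Lp nrm p a b. \<forall>t\<in>{c..d}.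
        B (\<lambda>\<theta>. \<eta> \<theta> + \<psi> \<theta>) t = B \<eta> t + B \<psi> t) \<and>
     (\<forall>k. \<forall>\<eta>\<in>Lp nrm p a b. \<forall>t\<in>{c..d}. B (\<lambda>\<theta>. k *\<^sub>R \<eta> \<theta>) t = k *\<^sub>R B \<eta> t) \<and>
     bounded_map (Lp nrm p a b) (Lp_norm nrm p a b) (C_norm nrm c d) B"

end

theory Submission
  imports Defs
begin

text \<open>Write \<open>p = \<alpha> + 1\<close>, so that \<open>q = p / \<alpha>\<close> and \<open>\<alpha> q = p\<close>.

  Everything happens on the interval of the first step: for \<open>t \<le> T \<le> r \<le> R\<close> and
  \<open>s \<in> [0,t]\<close> the delayed time \<open>s - r\<close> lies in \<open>[-R,0]\<close>. Hence \<open>y(t;\<phi>,r)\<close> is the explicit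
  integral of \<open>f(\<phi>(s - r))\<close> over \<open>[0,t]\<close> (\<open>y_part_eq\<close>), and an integral over \<open>[0,t]\<close> of a
  delayed function \<open>g(s - r)\<close> has norm at most the integral of \<open>|g|\<close> over all of \<open>[-R,0]\<close>
  (\<open>delayed_integral\<close>). The bounds for \<open>B_{\<phi>,r}\<close> and for differences of two such operators are
  then instances of Hoelder's inequality (\<open>matrix_Holder\<close>): the growth of \<open>Df\<close> makes
  \<open>\<parallel>Df \<circ> \<phi>\<parallel>\<^sup>q\<close> at most a constant times \<open>1 + |\<phi>|\<^sup>p\<close>, which is integrable.

  For the derivative, the difference to be estimated is the delayed integral of the Taylor
  remainder \<open>\<rho>(\<phi>,\<eta>) = f(\<phi> + \<eta>) - f(\<phi>) - Df(\<phi>)\<eta>\<close>, and it suffices that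
  \<open>\<integral>|\<rho>(\<phi>,\<eta>)| = o(\<parallel>\<eta>\<parallel>)\<close> over \<open>[-R,0]\<close>. This is obtained from one pointwise estimate
  (\<open>taylor_remainder_le\<close>),
  \<open>|\<rho>(x,h)| \<le> (\<epsilon> + K|h|\<^sup>\<alpha> + C|x|\<^sup>\<alpha> 1_{|x|>M}) |h|\<close>,
  in which \<open>\<epsilon> > 0\<close> and \<open>M \<ge> 1\<close> are at our disposal, \<open>K\<close> depends on both, and \<open>C\<close> depends on neither.
  For bounded \<open>x\<close> and small \<open>h\<close> it is the uniform continuity of \<open>Df\<close> on compact sets; for bounded
  \<open>x\<close> and \<open>h\<close> bounded away from zero, and for large \<open>x\<close>, it is the growth of \<open>Df\<close>. By Hoelder's
  inequality the three terms contribute \<open>\<parallel>\<eta>\<parallel>\<close> times, respectively, a fixed multiple of \<open>\<epsilon>\<close>,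
  \<open>K\<parallel>\<eta>\<parallel>\<^sup>\<alpha>\<close>, and \<open>C\<close> times the \<open>q\<close>-th root of \<open>\<integral>|\<phi>|\<^sup>p\<close> over \<open>{|\<phi>| > M}\<close>. One fixes
  \<open>\<epsilon>\<close>, then a large \<open>M\<close> by dominated convergence, and only then, \<open>K\<close> being known, requires
  \<open>\<parallel>\<eta>\<parallel>\<close> to be small.

  The sharp constant in the operator estimate forces one to work with the given norm and not with
  an equivalent Euclidean one. Two properties of it, \<open>|\<integral>g| \<le> \<integral>|g|\<close> and the mean value
  inequality, follow by testing against the linear functionals that the norm dominates
  (\<open>nrm_le_by_functionals\<close>, a form of the Hahn-Banach theorem).\<close>

section \<open>Norms on Euclidean space and their matrix norms\<close>

lemma op_norm_le:
  assumes "0 \<le> C" "\<And>v. v \<in> V \<Longrightarrow> q (B v) \<le> C * p v"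
  shows "op_norm V p q B \<le> C"
  unfolding op_norm_def using assms by (intro cInf_lower bdd_belowI[of _ 0]) auto

locale vec_norm =
  fixes nrm :: "real ^ 'n \<Rightarrow> real"
  assumes is_norm: "is_norm nrm"
begin

lemma nrm_nonneg [simp]: "0 \<le> nrm v"
  and nrm_eq_0_iff [simp]: "nrm v = 0 \<longleftrightarrow> v = 0"
  and nrm_scaleR: "nrm (c *\<^sub>R v) = \<bar>c\<bar> * nrm v"
  and nrm_triangle: "nrm (v + w) \<le> nrm v + nrm w"
  using is_norm unfolding is_norm_def by blast+

lemma nrm_zero [simp]: "nrm 0 = 0" by simp

lemma nrm_minus [simp]: "nrm (- v) = nrm v"
  using nrm_scaleR[of "-1" v] by simp

lemma nrm_triangle_diff: "nrm (v - w) \<le> nrm v + nrm w"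
  using nrm_triangle[of v "- w"] by simp

lemma nrm_pos: "v \<noteq> 0 \<Longrightarrow> 0 < nrm v"
  using nrm_nonneg[of v] nrm_eq_0_iff[of v] by linarith

lemma convex_on_nrm: "convex_on UNIV nrm"
proof (intro convex_onI)
  fix t :: real and v w :: "real ^ 'n"
  assume "0 < t" "t < 1"
  then show "nrm ((1 - t) *\<^sub>R v + t *\<^sub>R w) \<le> (1 - t) * nrm v + t * nrm w"
    using nrm_triangle[of "(1 - t) *\<^sub>R v" "t *\<^sub>R w"] by (simp add: nrm_scaleR)
qed simp

lemma continuous_on_nrm: "continuous_on S nrm"
  using convex_on_continuous[OF open_UNIV convex_on_nrm] continuous_on_subset by blast

lemma nrm_measurable [measurable]: "nrm \<in> borel_measurable borel"
  by (intro borel_measurable_continuous_onI continuous_on_nrm)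

lemma nrm_equivalent_norm:
  obtains a b where "0 < a" "0 < b" "\<And>v. a * norm v \<le> nrm v" "\<And>v. nrm v \<le> b * norm v"
proof -
  let ?S = "sphere (0 :: real ^ 'n) 1"
  have S: "compact ?S" "?S \<noteq> {}" by auto
  obtain u where u: "u \<in> ?S" "\<forall>v\<in>?S. nrm u \<le> nrm v"
    using continuous_attains_inf[OF S continuous_on_nrm] by blast
  obtain w where w: "w \<in> ?S" "\<forall>v\<in>?S. nrm v \<le> nrm w"
    using continuous_attains_sup[OF S continuous_on_nrm] by blast
  have un: "nrm v = norm v * nrm (v /\<^sub>R norm v)" if "v \<noteq> 0" for v
    using that by (simp add: nrm_scaleR)
  have mem: "v /\<^sub>R norm v \<in> ?S" if "v \<noteq> 0" for v :: "real ^ 'n"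
    using that by simp
  show ?thesis
  proof
    show "0 < nrm u" "0 < nrm w" using u w by (auto intro!: nrm_pos)
    show "nrm u * norm v \<le> nrm v" for v
    proof (cases "v = 0")
      case False
      show ?thesis
        using u(2) mem[OF False] unfolding un[OF False] by (simp add: mult.commute mult_left_mono)
    qed simp
    show "nrm v \<le> nrm w * norm v" for v
    proof (cases "v = 0")
      case False
      show ?thesis
        using w(2) mem[OF False] unfolding un[OF False] by (simp add: mult.commute mult_left_mono)
    qed simp
  qed
qed

text \<open>A norm value is recovered from the linear functionals that it bounds. If \<open>nrm z > c\<close>, a hyperplane
  strictly separates \<open>z\<close> from a ball of radius between \<open>c\<close> and \<open>nrm z\<close>; by homogeneity its normal
  \<open>a\<close> satisfies a lower bound of the form \<open>b * nrm v \<le> a \<bullet> v\<close> that fails at \<open>z\<close> when \<open>nrm v\<close> is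
  replaced by \<open>c\<close>. The sign \<open>b < 0\<close> reflects that such a bound is a rescaled
  \<open>- (a \<bullet> v) \<le> nrm v\<close>.\<close>
lemma nrm_le_by_functionals:
  assumes c: "0 \<le> c"
    and dual: "\<And>a b. b < 0 \<Longrightarrow> (\<And>v. b * nrm v \<le> a \<bullet> v) \<Longrightarrow> b * c \<le> a \<bullet> z"
  shows "nrm z \<le> c"
proof (rule ccontr)
  assume "\<not> nrm z \<le> c"
  then obtain d where d: "c < d" "d < nrm z" using dense[of c "nrm z"] by auto
  let ?S = "{v. nrm v \<le> d}"
  have "convex ?S"
  proof (rule convexI)
    fix v w and s t :: real
    assume vw: "v \<in> ?S" "w \<in> ?S" and st: "0 \<le> s" "0 \<le> t" "s + t = 1"
    have "nrm (s *\<^sub>R v + t *\<^sub>R w) \<le> s * nrm v + t * nrm w"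
      using nrm_triangle[of "s *\<^sub>R v" "t *\<^sub>R w"] st by (simp add: nrm_scaleR)
    also have "\<dots> \<le> d"
      using vw st by (intro convex_bound_le) auto
    finally show "s *\<^sub>R v + t *\<^sub>R w \<in> ?S" by simp
  qed
  moreover have "closed ?S"
    by (intro closed_Collect_le continuous_on_nrm continuous_on_const)
  moreover have "z \<notin> ?S" using d by simp
  ultimately obtain a b where ab: "a \<bullet> z < b" "\<And>v. nrm v \<le> d \<Longrightarrow> b < a \<bullet> v"
    using separating_hyperplane_closed_point[of ?S z] by blast
  have b0: "b < 0" using ab(2)[of 0] c d by simp
  have "b / d * nrm v \<le> a \<bullet> v" for v
  proof (cases "v = 0")
    case False
    then have n: "0 < nrm v" by (rule nrm_pos)
    have "b < a \<bullet> ((d / nrm v) *\<^sub>R v)"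
      using c d n by (intro ab(2)) (simp add: nrm_scaleR)
    also have "\<dots> = d / nrm v * (a \<bullet> v)" by simp
    finally show ?thesis using c d n by (simp add: field_simps)
  qed simp
  from dual[OF _ this] have "b / d * c \<le> a \<bullet> z" using b0 c d by (simp add: divide_neg_pos)
  moreover have "b < b / d * c" using b0 c d by (simp add: field_simps)
  ultimately show False using ab(1) by simp
qed

text \<open>A functional commutes with the integral, so each bound \<open>b * nrm v \<le> a \<bullet> v\<close> can be
  integrated.\<close>
lemma nrm_integral_le:
  assumes g: "integrable M g"
  shows "integrable M (\<lambda>x. nrm (g x))" "nrm (integral\<^sup>L M g) \<le> (\<integral>x. nrm (g x) \<partial>M)"
proof -
  obtain a b where ab: "0 < b" "\<And>v. nrm v \<le> b * norm v"
    using nrm_equivalent_norm by metis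
  have [measurable]: "g \<in> borel_measurable M" using g by simp
  show i: "integrable M (\<lambda>x. nrm (g x))"
    by (rule Bochner_Integration.integrable_bound[of M "\<lambda>x. b * norm (g x)"])
       (use g ab in auto)
  show "nrm (integral\<^sup>L M g) \<le> (\<integral>x. nrm (g x) \<partial>M)"
  proof (rule nrm_le_by_functionals)
    fix a b assume ab: "\<And>v. b * nrm v \<le> a \<bullet> v"
    have "b * (\<integral>x. nrm (g x) \<partial>M) = (\<integral>x. b * nrm (g x) \<partial>M)" by simp
    also have "\<dots> \<le> (\<integral>x. a \<bullet> g x \<partial>M)"
      by (intro integral_mono) (use i g ab in auto)
    also have "\<dots> = a \<bullet> integral\<^sup>L M g" using g by simp
    finally show "b * (\<integral>x. nrm (g x) \<partial>M) \<le> a \<bullet> integral\<^sup>L M g" .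
  qed simp
qed

lemma integrable_nrm_bound:
  assumes [measurable]: "g \<in> borel_measurable M" and "integrable M h"
    and "\<And>x. x \<in> space M \<Longrightarrow> nrm (g x) \<le> h x"
  shows "integrable M g"
proof -
  obtain a b where ab: "0 < a" "\<And>v. a * norm v \<le> nrm v"
    using nrm_equivalent_norm by metis
  show ?thesis
  proof (rule Bochner_Integration.integrable_bound[of M "\<lambda>x. h x / a"])
    show "AE x in M. norm (g x) \<le> norm (h x / a)"
    proof (rule AE_I2)
      fix x assume x: "x \<in> space M"
      have "a * norm (g x) \<le> h x" using ab(2)[of "g x"] assms(3)[OF x] by linarith
      then have "norm (g x) \<le> h x / a" using ab(1) by (simp add: field_simps)
      also have "\<dots> \<le> norm (h x / a)" unfolding real_norm_def by (rule abs_ge_self)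
      finally show "norm (g x) \<le> norm (h x / a)" .
    qed
  qed (use assms in auto)
qed

lemma mat_norm_le:
  assumes "0 \<le> C" "\<And>v. nrm (A *v v) \<le> C * nrm v"
  shows "mat_norm nrm A \<le> C"
  unfolding mat_norm_def using assms by (intro op_norm_le) auto

text \<open>The set of admissible bounds of a matrix is nonempty because \<open>nrm\<close> is equivalent to the
  Euclidean norm, and it is closed, so the infimum in the definition of the matrix norm is itself
  an admissible bound.\<close>
lemma mat_norm_nonneg [simp]: "0 \<le> mat_norm nrm A"
  and nrm_mult_le: "nrm (A *v v) \<le> mat_norm nrm A * nrm v"
proof -
  let ?K = "{C. 0 \<le> C \<and> (\<forall>v. nrm (A *v v) \<le> C * nrm v)}"
  obtain a b where ab: "0 < a" "0 < b" "\<And>v. a * norm v \<le> nrm v" "\<And>v. nrm v \<le> b * norm v"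
    using nrm_equivalent_norm by metis
  have "nrm (A *v v) \<le> (b * onorm ((*v) A) / a) * nrm v" for v
  proof -
    have "nrm (A *v v) \<le> b * (onorm ((*v) A) * norm v)"
      using ab(4)[of "A *v v"] onorm[OF matrix_vector_mul_bounded_linear, of A v] ab(2)
      by (meson mult_left_mono order_less_imp_le order_trans)
    also have "\<dots> \<le> b * (onorm ((*v) A) * (nrm v / a))"
      using ab onorm_pos_le[OF matrix_vector_mul_bounded_linear, of A]
      by (intro mult_left_mono) (auto simp: field_simps)
    finally show ?thesis by simp
  qed
  then have ne: "?K \<noteq> {}"
    using ab onorm_pos_le[OF matrix_vector_mul_bounded_linear, of A]
    by (auto intro!: exI[of _ "b * onorm ((*v) A) / a"])
  have eq: "mat_norm nrm A = Inf ?K" by (simp add: mat_norm_def op_norm_def)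
  show "0 \<le> mat_norm nrm A" unfolding eq using ne by (intro cInf_greatest) auto
  show "nrm (A *v v) \<le> mat_norm nrm A * nrm v"
  proof (cases "v = 0")
    case False
    then have n: "0 < nrm v" by (rule nrm_pos)
    have "nrm (A *v v) / nrm v \<le> Inf ?K"
      using ne n by (intro cInf_greatest) (auto simp: field_simps)
    then show ?thesis unfolding eq using n by (simp add: field_simps)
  qed simp
qed

lemma mat_norm_diff_le: "mat_norm nrm (A - B) \<le> mat_norm nrm A + mat_norm nrm B"
proof (rule mat_norm_le)
  fix v
  have "nrm ((A - B) *v v) \<le> nrm (A *v v) + nrm (B *v v)"
    by (simp add: matrix_vector_mult_diff_rdistrib nrm_triangle_diff)
  also have "\<dots> \<le> (mat_norm nrm A + mat_norm nrm B) * nrm v"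
    using nrm_mult_le[of A v] nrm_mult_le[of B v] by (simp add: distrib_right)
  finally show "nrm ((A - B) *v v) \<le> (mat_norm nrm A + mat_norm nrm B) * nrm v" .
qed simp

text \<open>The matrix norm is convex, and convex functions on a finite-dimensional space are continuous;
  this gives its measurability as well.\<close>
lemma continuous_on_mat_norm: "continuous_on S (mat_norm nrm)"
proof -
  have "convex_on UNIV (mat_norm nrm)"
  proof (intro convex_onI)
    fix t :: real and A B :: "real ^ 'n ^ 'n"
    assume t: "0 < t" "t < 1"
    let ?C = "(1 - t) * mat_norm nrm A + t * mat_norm nrm B"
    show "mat_norm nrm ((1 - t) *\<^sub>R A + t *\<^sub>R B) \<le> ?C"
    proof (rule mat_norm_le)
      fix v
      have "nrm (((1 - t) *\<^sub>R A + t *\<^sub>R B) *v v) \<le> (1 - t) * nrm (A *v v) + t * nrm (B *v v)"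
        using t nrm_triangle[of "(1 - t) *\<^sub>R (A *v v)" "t *\<^sub>R (B *v v)"]
        by (simp add: matrix_vector_mult_add_rdistrib nrm_scaleR flip: scaleR_matrix_vector_assoc)
      also have "\<dots> \<le> (1 - t) * (mat_norm nrm A * nrm v) + t * (mat_norm nrm B * nrm v)"
        using t by (intro add_mono mult_left_mono nrm_mult_le) auto
      finally show "nrm (((1 - t) *\<^sub>R A + t *\<^sub>R B) *v v) \<le> ?C * nrm v"
        by (simp add: algebra_simps)
    qed (use t in auto)
  qed simp
  then show ?thesis
    using convex_on_continuous[OF open_UNIV] continuous_on_subset by blast
qed

lemma mat_norm_measurable [measurable]: "mat_norm nrm \<in> borel_measurable borel"
  by (intro borel_measurable_continuous_onI continuous_on_mat_norm)

end

section \<open>Inequalities and limits for real integrals\<close>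

lemma powr_add_le:
  fixes x y p :: real
  assumes "0 \<le> x" "0 \<le> y" "0 \<le> p"
  shows "(x + y) powr p \<le> 2 powr p * (x powr p + y powr p)"
proof -
  have "(x + y) powr p \<le> (2 * max x y) powr p"
    using assms by (intro powr_mono2) auto
  also have "\<dots> = 2 powr p * max x y powr p"
    using assms by (simp add: powr_mult)
  also have "max x y powr p \<le> x powr p + y powr p"
    by (simp add: max_def)
  finally show ?thesis by simp
qed

text \<open>Young's inequality, applied to \<open>f\<close> and \<open>g\<close> after both have been scaled to norm one.\<close>
lemma Holder_integral_nonneg:
  fixes f g :: "'a \<Rightarrow> real" and p q :: real
  assumes pq: "1 < p" "1 < q" "1 / p + 1 / q = 1"
    and nn: "\<And>x. 0 \<le> f x" "\<And>x. 0 \<le> g x"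
    and [measurable]: "f \<in> borel_measurable M" "g \<in> borel_measurable M"
    and f: "integrable M (\<lambda>x. f x powr p)" and g: "integrable M (\<lambda>x. g x powr q)"
  shows "integrable M (\<lambda>x. f x * g x)"
    and "(\<integral>x. f x * g x \<partial>M) \<le> (\<integral>x. f x powr p \<partial>M) powr (1 / p) * (\<integral>x. g x powr q \<partial>M) powr (1 / q)"
proof -
  have young: "f x * g x \<le> f x powr p / p + g x powr q / q" for x
    using Youngs_inequality[of p q "f x" "g x"] pq nn by auto
  show i: "integrable M (\<lambda>x. f x * g x)"
    by (rule Bochner_Integration.integrable_bound[of M "\<lambda>x. f x powr p / p + g x powr q / q"])
       (use f g nn young order_trans[OF young abs_ge_self] in auto)
  let ?F = "\<integral>x. f x powr p \<partial>M" and ?G = "\<integral>x. g x powr q \<partial>M"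
  have F0: "0 \<le> ?F" and G0: "0 \<le> ?G" by simp_all
  show "(\<integral>x. f x * g x \<partial>M) \<le> ?F powr (1 / p) * ?G powr (1 / q)"
  proof (cases "?F = 0 \<or> ?G = 0")
    case True
    have "AE x in M. f x * g x = 0"
      using True
    proof
      assume "?F = 0"
      then have "AE x in M. f x powr p = 0"
        using integral_nonneg_eq_0_iff_AE[OF f] by simp
      then show ?thesis by eventually_elim simp
    next
      assume "?G = 0"
      then have "AE x in M. g x powr q = 0"
        using integral_nonneg_eq_0_iff_AE[OF g] by simp
      then show ?thesis by eventually_elim simp
    qed
    then have "(\<integral>x. f x * g x \<partial>M) = 0" by (simp add: integral_eq_zero_AE)
    then show ?thesis by simp
  next
    case False
    define a where "a = ?F powr (1 / p)"
    define b where "b = ?G powr (1 / q)"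
    have F: "0 < ?F" and G: "0 < ?G" using False F0 G0 by linarith+
    then have ab: "0 < a" "0 < b" by (auto simp: a_def b_def)
    have ap: "a powr p = ?F" and bq: "b powr q = ?G"
      using pq F G by (auto simp: a_def b_def powr_powr)
    have "f x * g x / (a * b) \<le> f x powr p / ?F / p + g x powr q / ?G / q" for x
      using Youngs_inequality[of p q "f x / a" "g x / b"] pq nn[of x] ab
      by (simp add: powr_divide ap bq)
    then have "(\<integral>x. f x * g x / (a * b) \<partial>M) \<le> (\<integral>x. f x powr p / ?F / p + g x powr q / ?G / q \<partial>M)"
      using i f g by (intro integral_mono) auto
    also have "\<dots> = 1 / p + 1 / q"
      using f g F G by simp
    finally show ?thesis using pq(3) ab by (simp add: a_def [symmetric] b_def[symmetric] field_simps)
  qed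
qed

lemma truncated_tail_tendsto_0:
  fixes g u :: "'a \<Rightarrow> real"
  assumes g: "integrable M g" and [measurable]: "u \<in> borel_measurable M"
  shows "(\<lambda>n. \<integral>x. (if real n < u x then g x else 0) \<partial>M) \<longlonglongrightarrow> 0"
proof -
  have [measurable]: "g \<in> borel_measurable M" using g by simp
  have "(\<lambda>n. \<integral>x. (if real n < u x then g x else 0) \<partial>M) \<longlonglongrightarrow> (\<integral>x. 0 \<partial>M)"
  proof (rule integral_dominated_convergence[where w = "\<lambda>x. \<bar>g x\<bar>"])
    show "AE x in M. (\<lambda>n. if real n < u x then g x else 0) \<longlonglongrightarrow> 0"
    proof (rule AE_I2, rule tendsto_eventually)
      fix x
      obtain m where m: "u x \<le> real m" using real_arch_simple by blast
      show "\<forall>\<^sub>F n in sequentially. (if real n < u x then g x else 0) = 0"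
        using eventually_ge_at_top[of m] by eventually_elim (use m in auto)
    qed
  qed (use g in auto)
  then show ?thesis by simp
qed

section \<open>Translates of integrals over intervals\<close>

lemma integrable_shift:
  fixes g :: "real \<Rightarrow> 'b::euclidean_space"
  assumes "integrable (lebesgue_on {a..b}) g"
  shows "integrable (lebesgue_on {a + r..b + r}) (\<lambda>s. g (s - r))"
    and "(LINT s|lebesgue_on {a + r..b + r}. g (s - r)) = integral\<^sup>L (lebesgue_on {a..b}) g"
proof -
  let ?h = "\<lambda>x. indicator {a..b} x *\<^sub>R g x"
  have eq: "indicator {a + r..b + r} s *\<^sub>R g (s - r) = ?h (- r + 1 * s)" for s
    by (auto simp: indicator_def)
  have "integrable lebesgue ?h"
    using assms by (simp add: integrable_restrict_space)
  then show "integrable (lebesgue_on {a + r..b + r}) (\<lambda>s. g (s - r))"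
    using lebesgue_integrable_real_affine[of ?h 1 "- r"]
    by (simp add: integrable_restrict_space eq del: mult_1)
  show "(LINT s|lebesgue_on {a + r..b + r}. g (s - r)) = integral\<^sup>L (lebesgue_on {a..b}) g"
    using lebesgue_integral_real_affine[of 1 ?h "- r"]
    by (simp add: integral_restrict_space eq del: mult_1)
qed

lemma integral_lebesgue_on_degenerate: "integral\<^sup>L (lebesgue_on {a..a :: real}) g = 0"
proof (rule integral_eq_zero_AE)
  have "{a} \<in> null_sets lebesgue" by (simp add: null_sets_completionI)
  then have "AE s in lebesgue. s \<notin> {a}" by (rule AE_not_in)
  then have "AE s in lebesgue. s \<in> {a..a} \<longrightarrow> g s = 0" by eventually_elim auto
  then show "AE s in lebesgue_on {a..a}. g s = 0" by (simp add: AE_restrict_space_iff)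
qed

lemma integrable_lebesgue_on_Icc_combine:
  fixes g :: "real \<Rightarrow> 'b::euclidean_space"
  assumes "integrable (lebesgue_on {a..b}) g" "integrable (lebesgue_on {b..c}) g" "a \<le> b" "b \<le> c"
  shows "integrable (lebesgue_on {a..c}) g"
proof -
  have "g absolutely_integrable_on ({a..b} \<union> {b..c})"
    using assms by (intro absolutely_integrable_Un)
      (auto simp: set_integrable_def integrable_restrict_space)
  moreover have "{a..b} \<union> {b..c} = {a..c}" using assms by auto
  ultimately show ?thesis by (simp add: set_integrable_def integrable_restrict_space)
qed

context vec_norm begin

text \<open>Since \<open>0 \<le> t \<le> r \<le> R\<close>, the delayed times \<open>s - r\<close> range over a subinterval of \<open>[-R,0]\<close>. This
  reduces every estimate uniform in \<open>t\<close> to an integral over the whole history interval.\<close>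
lemma delayed_integral:
  fixes g :: "real \<Rightarrow> real ^ 'n"
  assumes g: "integrable (lebesgue_on {-R..0}) g" and t: "0 \<le> t" "t \<le> r" "r \<le> R"
  shows "integrable (lebesgue_on {0..t}) (\<lambda>s. g (s - r))"
    and "nrm (LINT s|lebesgue_on {0..t}. g (s - r)) \<le> (LINT \<theta>|lebesgue_on {-R..0}. nrm (g \<theta>))"
proof -
  have sub: "{-r..t-r} \<subseteq> {-R..0}" using t by auto
  have g': "integrable (lebesgue_on {-r..t-r}) g"
    using integrable_subinterval[OF g sub] .
  show "integrable (lebesgue_on {0..t}) (\<lambda>s. g (s - r))"
    using integrable_shift(1)[OF g', of r] by simp
  have "nrm (LINT s|lebesgue_on {0..t}. g (s - r)) = nrm (integral\<^sup>L (lebesgue_on {-r..t-r}) g)"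
    using integrable_shift(2)[OF g', of r] by simp
  also have "\<dots> \<le> (LINT \<theta>|lebesgue_on {-r..t-r}. nrm (g \<theta>))"
    by (rule nrm_integral_le(2)[OF g'])
  also have "\<dots> \<le> (LINT \<theta>|lebesgue_on {-R..0}. nrm (g \<theta>))"
    using nrm_integral_le(1)[OF g] nrm_integral_le(1)[OF g'] sub
    by (auto simp: integrable_restrict_space integral_restrict_space indicator_def intro!: integral_mono)
  finally show "nrm (LINT s|lebesgue_on {0..t}. g (s - r)) \<le> (LINT \<theta>|lebesgue_on {-R..0}. nrm (g \<theta>))" .
qed

end

section \<open>The spaces of p-integrable functions\<close>

lemma Lp_norm_nonneg [simp]: "0 \<le> Lp_norm N p a b \<eta>"
  by (simp add: Lp_norm_def)

lemma measurable_matrix_vector_mult: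
  assumes "A \<in> borel_measurable M" "\<eta> \<in> borel_measurable M"
  shows "(\<lambda>\<theta>. (A \<theta> :: real ^ 'n ^ 'm) *v \<eta> \<theta>) \<in> borel_measurable M"
proof -
  have "continuous_on UNIV (\<lambda>x :: (real ^ 'n ^ 'm) \<times> (real ^ 'n). fst x *v snd x)"
    by (intro continuous_on_vec_lambda continuous_intros | simp add: matrix_vector_mult_def)+
  from borel_measurable_continuous_Pair[OF assms this] show ?thesis by simp
qed

context vec_norm begin

lemma LpD:
  assumes "\<eta> \<in> Lp nrm p a b"
  shows "\<eta> \<in> borel_measurable (lebesgue_on {a..b})"
    and "integrable (lebesgue_on {a..b}) (\<lambda>\<theta>. nrm (\<eta> \<theta>) powr p)"
  using assms by (auto simp: Lp_def)

lemma Lp_add: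
  assumes "\<eta> \<in> Lp nrm p a b" "\<psi> \<in> Lp nrm p a b" "0 \<le> p"
  shows "(\<lambda>\<theta>. \<eta> \<theta> + \<psi> \<theta>) \<in> Lp nrm p a b"
proof -
  note [measurable] = LpD(1)[OF assms(1)] LpD(1)[OF assms(2)]
  have "integrable (lebesgue_on {a..b}) (\<lambda>\<theta>. nrm (\<eta> \<theta> + \<psi> \<theta>) powr p)"
  proof (rule Bochner_Integration.integrable_bound)
    show "integrable (lebesgue_on {a..b}) (\<lambda>\<theta>. 2 powr p * (nrm (\<eta> \<theta>) powr p + nrm (\<psi> \<theta>) powr p))"
      using LpD(2)[OF assms(1)] LpD(2)[OF assms(2)] by simp
    have "nrm (\<eta> \<theta> + \<psi> \<theta>) powr p \<le> 2 powr p * (nrm (\<eta> \<theta>) powr p + nrm (\<psi> \<theta>) powr p)" for \<theta>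
      using powr_mono2[OF assms(3) nrm_nonneg nrm_triangle, of "\<eta> \<theta>" "\<psi> \<theta>"]
        powr_add_le[OF nrm_nonneg nrm_nonneg assms(3), of "\<eta> \<theta>" "\<psi> \<theta>"] by linarith
    then show "AE \<theta> in lebesgue_on {a..b}. norm (nrm (\<eta> \<theta> + \<psi> \<theta>) powr p) \<le>
        norm (2 powr p * (nrm (\<eta> \<theta>) powr p + nrm (\<psi> \<theta>) powr p))"
      by simp
  qed measurable
  then show ?thesis by (simp add: Lp_def)
qed

lemma matrix_Holder:
  assumes pq: "1 < p" "1 < q" "1 / p + 1 / q = 1"
    and \<eta>: "\<eta> \<in> Lp nrm p a b"
    and A [measurable]: "A \<in> borel_measurable (lebesgue_on {a..b})"
    and Aq: "integrable (lebesgue_on {a..b}) (\<lambda>\<theta>. mat_norm nrm (A \<theta>) powr q)"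
  shows "integrable (lebesgue_on {a..b}) (\<lambda>\<theta>. A \<theta> *v \<eta> \<theta>)"
    and "(LINT \<theta>|lebesgue_on {a..b}. nrm (A \<theta> *v \<eta> \<theta>))
           \<le> Lp_norm (mat_norm nrm) q a b A * Lp_norm nrm p a b \<eta>"
proof -
  note [measurable] = LpD(1)[OF \<eta>] measurable_matrix_vector_mult[OF A LpD(1)[OF \<eta>]]
  have h: "integrable (lebesgue_on {a..b}) (\<lambda>\<theta>. nrm (\<eta> \<theta>) * mat_norm nrm (A \<theta>))"
    "(LINT \<theta>|lebesgue_on {a..b}. nrm (\<eta> \<theta>) * mat_norm nrm (A \<theta>))
       \<le> Lp_norm nrm p a b \<eta> * Lp_norm (mat_norm nrm) q a b A"
    unfolding Lp_norm_def
    by (rule Holder_integral_nonneg; use pq LpD(2)[OF \<eta>] Aq in simp)+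
  have le: "nrm (A \<theta> *v \<eta> \<theta>) \<le> nrm (\<eta> \<theta>) * mat_norm nrm (A \<theta>)" for \<theta>
    using nrm_mult_le[of "A \<theta>" "\<eta> \<theta>"] by (simp add: mult.commute)
  show i: "integrable (lebesgue_on {a..b}) (\<lambda>\<theta>. A \<theta> *v \<eta> \<theta>)"
    by (rule integrable_nrm_bound[OF _ h(1) le]) measurable
  have "(LINT \<theta>|lebesgue_on {a..b}. nrm (A \<theta> *v \<eta> \<theta>))
      \<le> (LINT \<theta>|lebesgue_on {a..b}. nrm (\<eta> \<theta>) * mat_norm nrm (A \<theta>))"
    by (intro integral_mono nrm_integral_le(1)[OF i] h(1) le)
  also note h(2)
  finally show "(LINT \<theta>|lebesgue_on {a..b}. nrm (A \<theta> *v \<eta> \<theta>))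
           \<le> Lp_norm (mat_norm nrm) q a b A * Lp_norm nrm p a b \<eta>"
    by (simp add: mult.commute)
qed

section \<open>The Taylor remainder of a map whose derivative has power growth\<close>

text \<open>The mean value inequality for an arbitrary norm, with constant one: along each functional
  \<open>a\<close> the real mean value theorem yields an intermediate \<open>\<tau>\<close>, which may depend on \<open>a\<close>, but the
  bound \<open>B\<close> does not.\<close>
lemma nrm_linearization_le:
  assumes diff: "\<And>x. f differentiable (at x)"
    and B: "\<And>\<tau>. 0 < \<tau> \<Longrightarrow> \<tau> < 1 \<Longrightarrow> mat_norm nrm (Df f (x + \<tau> *\<^sub>R h) - Df f x) \<le> B"
  shows "nrm (f (x + h) - f x - Df f x *v h) \<le> B * nrm h"
proof (rule nrm_le_by_functionals)
  have "0 \<le> B" using order_trans[OF mat_norm_nonneg B[of "1 / 2"]] by simp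
  then show "0 \<le> B * nrm h" by simp
  fix a b assume ab: "b < 0" "\<And>v. b * nrm v \<le> a \<bullet> v"
  have D: "((\<lambda>\<tau>. a \<bullet> (f (x + \<tau> *\<^sub>R h) - \<tau> *\<^sub>R (Df f x *v h)))
      has_real_derivative a \<bullet> ((Df f (x + \<tau> *\<^sub>R h) - Df f x) *v h)) (at \<tau>)" for \<tau>
  proof -
    have "(f has_derivative (\<lambda>v. Df f (x + \<tau> *\<^sub>R h) *v v)) (at (x + \<tau> *\<^sub>R h))"
      using diff jacobian_works by blast
    moreover have "((\<lambda>s. x + s *\<^sub>R h) has_derivative (\<lambda>s. s *\<^sub>R h)) (at \<tau>)"
      by (auto intro!: derivative_eq_intros)
    ultimately have [derivative_intros]:
      "((\<lambda>s. f (x + s *\<^sub>R h)) has_derivative (\<lambda>s. Df f (x + \<tau> *\<^sub>R h) *v (s *\<^sub>R h))) (at \<tau>)"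
      by (rule has_derivative_compose[rotated])
    have "((\<lambda>\<tau>. a \<bullet> (f (x + \<tau> *\<^sub>R h) - \<tau> *\<^sub>R (Df f x *v h)))
      has_derivative (\<lambda>s. a \<bullet> (Df f (x + \<tau> *\<^sub>R h) *v (s *\<^sub>R h) - s *\<^sub>R (Df f x *v h)))) (at \<tau>)"
      by (auto intro!: derivative_eq_intros)
    moreover have "a \<bullet> (Df f (x + \<tau> *\<^sub>R h) *v (s *\<^sub>R h) - s *\<^sub>R (Df f x *v h))
        = (a \<bullet> ((Df f (x + \<tau> *\<^sub>R h) - Df f x) *v h)) * s" for s
      by (simp add: matrix_vector_mult_diff_rdistrib matrix_vector_mult_scaleR algebra_simps)
    ultimately show ?thesis by (simp add: has_field_derivative_def)
  qed
  obtain \<tau> where \<tau>: "0 < \<tau>" "\<tau> < 1"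
    and eq: "a \<bullet> (f (x + h) - Df f x *v h) - a \<bullet> f x = a \<bullet> ((Df f (x + \<tau> *\<^sub>R h) - Df f x) *v h)"
    using MVT2[OF zero_less_one D] by auto
  have "nrm ((Df f (x + \<tau> *\<^sub>R h) - Df f x) *v h) \<le> B * nrm h"
    using nrm_mult_le[of "Df f (x + \<tau> *\<^sub>R h) - Df f x" h] mult_right_mono[OF B[OF \<tau>] nrm_nonneg, of h]
    by linarith
  then have "b * (B * nrm h) \<le> b * nrm ((Df f (x + \<tau> *\<^sub>R h) - Df f x) *v h)"
    using ab(1) by (simp add: mult_left_mono_neg)
  also have "\<dots> \<le> a \<bullet> ((Df f (x + \<tau> *\<^sub>R h) - Df f x) *v h)" by (rule ab(2))
  also have "\<dots> = a \<bullet> (f (x + h) - f x - Df f x *v h)"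
    using eq by (simp add: inner_diff_right)
  finally show "b * (B * nrm h) \<le> a \<bullet> (f (x + h) - f x - Df f x *v h)" .
qed

end

locale C1_power_growth = vec_norm nrm for nrm :: "real ^ 'n \<Rightarrow> real" +
  fixes f :: "real ^ 'n \<Rightarrow> real ^ 'n" and \<alpha> q :: real
  assumes C1: "class_C1 f"
    and alpha: "1 \<le> \<alpha>"
    and growth: "\<exists>C>0. \<exists>K>0. \<forall>x. nrm x \<ge> K \<longrightarrow> mat_norm nrm (Df f x) \<le> C * nrm x powr \<alpha>"
    and conj: "1 / (\<alpha> + 1) + 1 / q = 1"
begin

lemma differentiable: "f differentiable (at x)"
  and continuous_on_Df: "continuous_on S (Df f)"
  using C1 continuous_on_subset unfolding class_C1_def by blast+

lemma continuous_on_f: "continuous_on S f"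
  using differentiable
  by (intro differentiable_imp_continuous_on) (simp add: differentiable_at_imp_differentiable_on)

lemma f_measurable [measurable]: "f \<in> borel_measurable borel"
  by (intro borel_measurable_continuous_onI continuous_on_f)

lemma Df_measurable [measurable]: "Df f \<in> borel_measurable borel"
  by (intro borel_measurable_continuous_onI continuous_on_Df)

lemma q_eq: "q = (\<alpha> + 1) / \<alpha>"
proof -
  have "1 / q = \<alpha> / (\<alpha> + 1)" using conj alpha by (simp add: field_simps)
  then have "inverse (1 / q) = inverse (\<alpha> / (\<alpha> + 1))" by simp
  then show ?thesis by simp
qed

lemma alpha_q: "\<alpha> * q = \<alpha> + 1"
  and q_gt_1: "1 < q"
  using alpha by (simp_all add: q_eq)

lemma compact_nrm_ball: "compact {x. nrm x \<le> M}"
proof -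
  obtain a b where ab: "0 < a" "\<And>v. a * norm v \<le> nrm v"
    using nrm_equivalent_norm by metis
  have "norm v \<le> M / a" if "nrm v \<le> M" for v
    using ab(1) ab(2)[of v] that by (simp add: field_simps)
  then have "bounded {x. nrm x \<le> M}" by (auto simp: bounded_iff)
  moreover have "closed {x. nrm x \<le> M}"
    by (intro closed_Collect_le continuous_on_nrm continuous_on_const)
  ultimately show ?thesis by (simp add: compact_eq_bounded_closed)
qed

lemma Df_global_growth:
  obtains C where "0 \<le> C" "\<And>x. mat_norm nrm (Df f x) \<le> C * (1 + nrm x powr \<alpha>)"
proof -
  obtain C K where C: "0 < C" "\<And>x. K \<le> nrm x \<Longrightarrow> mat_norm nrm (Df f x) \<le> C * nrm x powr \<alpha>"
    using growth by blast
  have "compact ((\<lambda>x. mat_norm nrm (Df f x)) ` {x. nrm x \<le> K})"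
    by (intro compact_continuous_image compact_nrm_ball
        continuous_on_compose2[OF continuous_on_mat_norm[of UNIV] continuous_on_Df]) auto
  then obtain D where "\<forall>y \<in> (\<lambda>x. mat_norm nrm (Df f x)) ` {x. nrm x \<le> K}. norm y \<le> D"
    using compact_imp_bounded bounded_iff by metis
  then have D: "mat_norm nrm (Df f x) \<le> D" if "nrm x \<le> K" for x
    using that by (auto dest: abs_le_D1)
  show ?thesis
  proof
    show "0 \<le> C + \<bar>D\<bar>" using C by simp
    show "mat_norm nrm (Df f x) \<le> (C + \<bar>D\<bar>) * (1 + nrm x powr \<alpha>)" for x
    proof (cases "K \<le> nrm x")
      case True
      have "C * nrm x powr \<alpha> \<le> (C + \<bar>D\<bar>) * (1 + nrm x powr \<alpha>)"
        using C by (intro mult_mono) auto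
      then show ?thesis using C(2)[OF True] by linarith
    next
      case False
      have "\<bar>D\<bar> * 1 \<le> (C + \<bar>D\<bar>) * (1 + nrm x powr \<alpha>)"
        using C by (intro mult_mono) auto
      then show ?thesis using D[of x] False by simp
    qed
  qed
qed

lemma Df_oscillation_growth:
  obtains C where "0 \<le> C"
    "\<And>x h \<tau>. 0 < \<tau> \<Longrightarrow> \<tau> < 1 \<Longrightarrow> mat_norm nrm (Df f (x + \<tau> *\<^sub>R h) - Df f x)
       \<le> C * (1 + nrm x powr \<alpha> + nrm h powr \<alpha>)"
proof -
  obtain C where C: "0 \<le> C" "\<And>x. mat_norm nrm (Df f x) \<le> C * (1 + nrm x powr \<alpha>)"
    using Df_global_growth by blast
  show ?thesis
  proof
    show "0 \<le> C * (2 + 2 powr \<alpha>)" using C by simp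
    fix x h and \<tau> :: real assume \<tau>: "0 < \<tau>" "\<tau> < 1"
    have "\<bar>\<tau>\<bar> * nrm h \<le> nrm h"
      using \<tau> by (simp add: mult_left_le_one_le)
    then have "nrm (x + \<tau> *\<^sub>R h) \<le> nrm x + nrm h"
      using nrm_triangle[of x "\<tau> *\<^sub>R h"] by (simp add: nrm_scaleR)
    then have "nrm (x + \<tau> *\<^sub>R h) powr \<alpha> \<le> 2 powr \<alpha> * (nrm x powr \<alpha> + nrm h powr \<alpha>)"
      using alpha by (intro order_trans[OF powr_mono2 powr_add_le]) auto
    then have "C * (1 + nrm (x + \<tau> *\<^sub>R h) powr \<alpha>) \<le> C * (1 + 2 powr \<alpha> * (nrm x powr \<alpha> + nrm h powr \<alpha>))"
      using C(1) by (intro mult_left_mono) auto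
    moreover have "C * (1 + 2 powr \<alpha> * (nrm x powr \<alpha> + nrm h powr \<alpha>)) + C * (1 + nrm x powr \<alpha>)
       \<le> C * ((2 + 2 powr \<alpha>) * (1 + nrm x powr \<alpha> + nrm h powr \<alpha>))"
      unfolding distrib_left[symmetric] using C(1)
      by (intro mult_left_mono) (auto simp: algebra_simps)
    ultimately show "mat_norm nrm (Df f (x + \<tau> *\<^sub>R h) - Df f x)
        \<le> C * (2 + 2 powr \<alpha>) * (1 + nrm x powr \<alpha> + nrm h powr \<alpha>)"
      using mat_norm_diff_le[of "Df f (x + \<tau> *\<^sub>R h)" "Df f x"] C(2)[of x] C(2)[of "x + \<tau> *\<^sub>R h"]
      by (simp add: mult.assoc)
  qed
qed

text \<open>The oscillation of \<open>Df\<close> along a short segment is uniformly small as long as its starting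
  point stays in a fixed ball; limiting the length of \<open>h\<close> by one keeps the whole segment inside the
  ball of radius \<open>M + 1\<close>, where \<open>Df\<close> is uniformly continuous.\<close>
lemma Df_uniformly_close:
  assumes "0 < \<epsilon>"
  obtains \<delta> where "0 < \<delta>"
    "\<And>x h \<tau>. nrm x \<le> M \<Longrightarrow> nrm h \<le> \<delta> \<Longrightarrow> 0 < \<tau> \<Longrightarrow> \<tau> < 1 \<Longrightarrow>
       mat_norm nrm (Df f (x + \<tau> *\<^sub>R h) - Df f x) \<le> \<epsilon>"
proof -
  obtain e where e: "0 < e" "\<And>A. dist A 0 < e \<Longrightarrow> dist (mat_norm nrm A) (mat_norm nrm 0) < \<epsilon>"
    using continuous_on_mat_norm[of UNIV] assms unfolding continuous_on_iff by blast
  have m0: "mat_norm nrm 0 = 0"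
    using mat_norm_le[of 0 0] by (intro antisym) simp_all
  obtain d where d: "0 < d"
    "\<And>x y. nrm x \<le> M + 1 \<Longrightarrow> nrm y \<le> M + 1 \<Longrightarrow> dist y x < d \<Longrightarrow> dist (Df f y) (Df f x) < e"
    using compact_uniformly_continuous[OF continuous_on_Df compact_nrm_ball, of "M + 1"] e(1)
    unfolding uniformly_continuous_on_def by (metis mem_Collect_eq)
  obtain a b where ab: "0 < a" "\<And>v. a * norm v \<le> nrm v"
    using nrm_equivalent_norm by metis
  show ?thesis
  proof
    show "0 < min 1 (d * a / 2)" using d ab by simp
    fix x h and \<tau> :: real
    assume x: "nrm x \<le> M" and h: "nrm h \<le> min 1 (d * a / 2)" and \<tau>: "0 < \<tau>" "\<tau> < 1"
    have sh: "\<bar>\<tau>\<bar> * nrm h \<le> nrm h" "\<bar>\<tau>\<bar> * norm h \<le> norm h"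
      using \<tau> by (simp_all add: mult_left_le_one_le)
    have "nrm (x + \<tau> *\<^sub>R h) \<le> M + 1"
      using nrm_triangle[of x "\<tau> *\<^sub>R h"] sh x h by (simp add: nrm_scaleR)
    moreover have "a * norm h < a * d"
      using ab(2)[of h] h mult_pos_pos[OF d(1) ab(1)] by (auto simp: mult.commute)
    then have "norm h < d" using ab(1) by simp
    then have "dist (x + \<tau> *\<^sub>R h) x < d" using sh by (simp add: dist_norm)
    ultimately have "dist (Df f (x + \<tau> *\<^sub>R h)) (Df f x) < e"
      using x by (intro d(2)) auto
    then have "dist (Df f (x + \<tau> *\<^sub>R h) - Df f x) 0 < e" by (simp add: dist_norm)
    from e(2)[OF this] show "mat_norm nrm (Df f (x + \<tau> *\<^sub>R h) - Df f x) \<le> \<epsilon>"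
      by (simp add: m0 dist_norm)
  qed
qed

definition taylor_remainder :: "real ^ 'n \<Rightarrow> real ^ 'n \<Rightarrow> real ^ 'n" where
  "taylor_remainder x h = f (x + h) - f x - Df f x *v h"

text \<open>The pointwise form of differentiability that survives integration. The constant \<open>C\<close> comes
  first because \<open>M\<close> is later chosen to beat it, whereas \<open>K\<close> may depend on \<open>\<epsilon>\<close> and \<open>M\<close>: its
  term carries the extra power of \<open>h\<close> and is made small by shrinking \<open>h\<close>.\<close>
lemma taylor_remainder_le:
  obtains C where "0 \<le> C"
    "\<And>\<epsilon> M. 0 < \<epsilon> \<Longrightarrow> 1 \<le> M \<Longrightarrow> \<exists>K\<ge>0. \<forall>x h. nrm (taylor_remainder x h)
       \<le> (\<epsilon> + K * nrm h powr \<alpha> + (if M < nrm x then C * nrm x powr \<alpha> else 0)) * nrm h"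
proof -
  obtain C where C: "0 \<le> C"
    "\<And>x h \<tau>. 0 < \<tau> \<Longrightarrow> \<tau> < 1 \<Longrightarrow> mat_norm nrm (Df f (x + \<tau> *\<^sub>R h) - Df f x)
       \<le> C * (1 + nrm x powr \<alpha> + nrm h powr \<alpha>)"
    using Df_oscillation_growth by blast
  show ?thesis
  proof
    show "0 \<le> 2 * C" using C by simp
    fix \<epsilon> M :: real assume \<epsilon>: "0 < \<epsilon>" and M: "1 \<le> M"
    obtain d where d: "0 < d"
      "\<And>x h \<tau>. nrm x \<le> M \<Longrightarrow> nrm h \<le> d \<Longrightarrow> 0 < \<tau> \<Longrightarrow> \<tau> < 1 \<Longrightarrow>
         mat_norm nrm (Df f (x + \<tau> *\<^sub>R h) - Df f x) \<le> \<epsilon>"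
      using Df_uniformly_close[OF \<epsilon>] by metis
    \<comment> \<open>For \<open>d < nrm h\<close> any constant is absorbed into a multiple of \<open>(nrm h / d) powr \<alpha>\<close>.\<close>
    define K where "K = C * (1 + M powr \<alpha>) / d powr \<alpha> + C"
    have K: "C \<le> K" "0 \<le> K" using C d by (auto simp: K_def)
    have "nrm (taylor_remainder x h)
       \<le> (\<epsilon> + K * nrm h powr \<alpha> + (if M < nrm x then 2 * C * nrm x powr \<alpha> else 0)) * nrm h" for x h
      unfolding taylor_remainder_def
    proof (rule nrm_linearization_le[OF differentiable])
      fix \<tau> :: real assume \<tau>: "0 < \<tau>" "\<tau> < 1"
      let ?m = "mat_norm nrm (Df f (x + \<tau> *\<^sub>R h) - Df f x)"
      have CK: "C * nrm h powr \<alpha> \<le> K * nrm h powr \<alpha>" using K by (simp add: mult_right_mono)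
      consider "M < nrm x" | "nrm x \<le> M" "nrm h \<le> d" | "nrm x \<le> M" "d < nrm h" by linarith
      then show "?m \<le> \<epsilon> + K * nrm h powr \<alpha> + (if M < nrm x then 2 * C * nrm x powr \<alpha> else 0)"
      proof cases
        case 1
        then have "1 \<le> nrm x powr \<alpha>" using M alpha by (intro ge_one_powr_ge_zero) auto
        then have "C * 1 \<le> C * nrm x powr \<alpha>" using C(1) by (rule mult_left_mono)
        then show ?thesis using C(2)[OF \<tau>, of x h] CK \<epsilon> 1 by (simp add: algebra_simps)
      next
        case 2
        have "0 \<le> K * nrm h powr \<alpha>" using K by simp
        then show ?thesis using d(2)[OF 2 \<tau>] 2 by simp
      next
        case 3
        have "d powr \<alpha> \<le> nrm h powr \<alpha>" using 3 d alpha by (intro powr_mono2) auto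
        then have "1 \<le> nrm h powr \<alpha> / d powr \<alpha>" using d by simp
        moreover have "nrm x powr \<alpha> \<le> M powr \<alpha>" using 3 alpha by (intro powr_mono2) auto
        ultimately have "C * (1 + nrm x powr \<alpha>) * 1 \<le> C * (1 + M powr \<alpha>) * (nrm h powr \<alpha> / d powr \<alpha>)"
          using C(1) by (intro mult_mono mult_nonneg_nonneg) auto
        then show ?thesis using C(2)[OF \<tau>, of x h] \<epsilon> 3 by (simp add: K_def algebra_simps)
      qed
    qed
    then show "\<exists>K\<ge>0. \<forall>x h. nrm (taylor_remainder x h)
       \<le> (\<epsilon> + K * nrm h powr \<alpha> + (if M < nrm x then 2 * C * nrm x powr \<alpha> else 0)) * nrm h"
      using K by blast
  qed
qed

section \<open>Composition with p-integrable functions\<close>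

lemma Df_comp_measurable:
  assumes "\<phi> \<in> Lp nrm (\<alpha> + 1) a b"
  shows "(\<lambda>\<theta>. Df f (\<phi> \<theta>)) \<in> borel_measurable (lebesgue_on {a..b})"
  by (rule measurable_compose[OF LpD(1)[OF assms] Df_measurable])

lemma Df_comp_Lq:
  assumes \<phi>: "\<phi> \<in> Lp nrm (\<alpha> + 1) a b"
  shows "integrable (lebesgue_on {a..b}) (\<lambda>\<theta>. mat_norm nrm (Df f (\<phi> \<theta>)) powr q)"
proof -
  obtain C where C: "0 \<le> C" "\<And>x. mat_norm nrm (Df f x) \<le> C * (1 + nrm x powr \<alpha>)"
    using Df_global_growth by blast
  note [measurable] = Df_comp_measurable[OF \<phi>]
  show ?thesis
  proof (rule Bochner_Integration.integrable_bound)
    show "integrable (lebesgue_on {a..b}) (\<lambda>\<theta>. C powr q * (2 powr q * (1 + nrm (\<phi> \<theta>) powr (\<alpha> + 1))))"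
      using LpD(2)[OF \<phi>]
      by (intro integrable_mult_right Bochner_Integration.integrable_add
          continuous_imp_integrable_real[OF continuous_on_const])
    have "mat_norm nrm (Df f x) powr q \<le> C powr q * (2 powr q * (1 + nrm x powr (\<alpha> + 1)))" for x
    proof -
      have "mat_norm nrm (Df f x) powr q \<le> C powr q * (1 + nrm x powr \<alpha>) powr q"
        using powr_mono2[OF _ mat_norm_nonneg C(2), of q x] q_gt_1 C(1) by (simp add: powr_mult)
      also have "\<dots> \<le> C powr q * (2 powr q * (1 powr q + (nrm x powr \<alpha>) powr q))"
        using q_gt_1 by (intro mult_left_mono powr_add_le) auto
      finally show ?thesis by (simp add: powr_powr alpha_q)
    qed
    then show "AE \<theta> in lebesgue_on {a..b}. norm (mat_norm nrm (Df f (\<phi> \<theta>)) powr q)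
        \<le> norm (C powr q * (2 powr q * (1 + nrm (\<phi> \<theta>) powr (\<alpha> + 1))))"
      by simp
  qed measurable
qed

lemma Df_diff_comp_Lq:
  assumes \<phi>: "\<phi> \<in> Lp nrm (\<alpha> + 1) a b" and \<psi>: "\<psi> \<in> Lp nrm (\<alpha> + 1) a b"
  shows "integrable (lebesgue_on {a..b}) (\<lambda>\<theta>. mat_norm nrm (Df f (\<phi> \<theta>) - Df f (\<psi> \<theta>)) powr q)"
proof -
  note [measurable] = Df_comp_measurable[OF \<phi>] Df_comp_measurable[OF \<psi>]
  show ?thesis
  proof (rule Bochner_Integration.integrable_bound)
    show "integrable (lebesgue_on {a..b}) (\<lambda>\<theta>. 2 powr q *
        (mat_norm nrm (Df f (\<phi> \<theta>)) powr q + mat_norm nrm (Df f (\<psi> \<theta>)) powr q))"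
      using Df_comp_Lq[OF \<phi>] Df_comp_Lq[OF \<psi>] by simp
    have "mat_norm nrm (A - B) powr q \<le> 2 powr q * (mat_norm nrm A powr q + mat_norm nrm B powr q)" for A B
      using q_gt_1 by (intro order_trans[OF powr_mono2 powr_add_le] mat_norm_diff_le) auto
    then show "AE \<theta> in lebesgue_on {a..b}. norm (mat_norm nrm (Df f (\<phi> \<theta>) - Df f (\<psi> \<theta>)) powr q)
        \<le> norm (2 powr q * (mat_norm nrm (Df f (\<phi> \<theta>)) powr q + mat_norm nrm (Df f (\<psi> \<theta>)) powr q))"
      by simp
  qed measurable
qed

lemma taylor_remainder_measurable:
  assumes "\<phi> \<in> Lp nrm (\<alpha> + 1) a b" "\<eta> \<in> Lp nrm (\<alpha> + 1) a b"
  shows "(\<lambda>\<theta>. taylor_remainder (\<phi> \<theta>) (\<eta> \<theta>)) \<in> borel_measurable (lebesgue_on {a..b})"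
proof -
  note [measurable] = LpD(1)[OF assms(1)] LpD(1)[OF assms(2)]
    measurable_matrix_vector_mult[OF Df_comp_measurable[OF assms(1)] LpD(1)[OF assms(2)]]
  show ?thesis unfolding taylor_remainder_def by measurable
qed

text \<open>The pointwise bound is integrated term by term, the first and the third term by Hoelder's
  inequality. The second one is exact: \<open>|\<eta>|\<^sup>\<alpha> |\<eta>| = |\<eta>|\<^sup>p\<close> integrates to \<open>\<parallel>\<eta>\<parallel>\<^sup>\<alpha> \<parallel>\<eta>\<parallel>\<close>. In the third one the exponent
  \<open>\<alpha> q = p\<close> turns the truncated \<open>C |\<phi>|\<^sup>\<alpha>\<close> into an integrable function.\<close>
lemma taylor_remainder_integral_le:
  assumes \<phi>: "\<phi> \<in> Lp nrm (\<alpha> + 1) a b" and \<eta>: "\<eta> \<in> Lp nrm (\<alpha> + 1) a b"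
    and const: "0 \<le> \<epsilon>" "0 \<le> K" "0 \<le> C"
    and remainder: "\<And>x h. nrm (taylor_remainder x h)
       \<le> (\<epsilon> + K * nrm h powr \<alpha> + (if M < nrm x then C * nrm x powr \<alpha> else 0)) * nrm h"
  shows "integrable (lebesgue_on {a..b}) (\<lambda>\<theta>. taylor_remainder (\<phi> \<theta>) (\<eta> \<theta>))"
    and "(LINT \<theta>|lebesgue_on {a..b}. nrm (taylor_remainder (\<phi> \<theta>) (\<eta> \<theta>)))
      \<le> (\<epsilon> * (LINT \<theta>|lebesgue_on {a..b}. 1) powr (1 / q) + K * Lp_norm nrm (\<alpha> + 1) a b \<eta> powr \<alpha>
         + (LINT \<theta>|lebesgue_on {a..b}. (if M < nrm (\<phi> \<theta>) then C powr q * nrm (\<phi> \<theta>) powr (\<alpha> + 1) else 0))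
             powr (1 / q))
        * Lp_norm nrm (\<alpha> + 1) a b \<eta>"
proof -
  let ?L = "lebesgue_on {a..b}" and ?p = "\<alpha> + 1" and ?N = "Lp_norm nrm (\<alpha> + 1) a b \<eta>"
  define V where "V = (LINT \<theta>|?L. 1) powr (1 / q)"
  have p: "1 < ?p" using alpha by simp
  note [measurable] = LpD(1)[OF \<phi>] LpD(1)[OF \<eta>] taylor_remainder_measurable[OF \<phi> \<eta>]
  define w where "w \<theta> = (if M < nrm (\<phi> \<theta>) then C * nrm (\<phi> \<theta>) powr \<alpha> else 0)" for \<theta>
  define wq where "wq \<theta> = (if M < nrm (\<phi> \<theta>) then C powr q * nrm (\<phi> \<theta>) powr ?p else 0)" for \<theta>
  have [measurable]: "w \<in> borel_measurable ?L" "wq \<in> borel_measurable ?L"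
    unfolding w_def wq_def by measurable
  have w0: "0 \<le> w \<theta>" for \<theta> using const by (simp add: w_def)
  have w_eq: "(\<lambda>\<theta>. w \<theta> powr q) = wq"
    using const by (auto simp: w_def wq_def powr_mult powr_powr alpha_q)
  have wq: "integrable ?L wq"
    by (rule Bochner_Integration.integrable_bound[of _ "\<lambda>\<theta>. C powr q * nrm (\<phi> \<theta>) powr ?p"])
      (use LpD(2)[OF \<phi>] in \<open>auto simp: wq_def\<close>)
  have one: "integrable ?L (\<lambda>_. 1 :: real)"
    by (intro continuous_imp_integrable_real continuous_on_const)
  have h1: "integrable ?L (\<lambda>\<theta>. nrm (\<eta> \<theta>) * 1)" "(LINT \<theta>|?L. nrm (\<eta> \<theta>) * 1) \<le> ?N * V"
    using Holder_integral_nonneg[OF p q_gt_1 conj, of "\<lambda>\<theta>. nrm (\<eta> \<theta>)" "\<lambda>_. 1" ?L] LpD(2)[OF \<eta>] one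
    by (simp_all add: Lp_norm_def V_def)
  have h2: "integrable ?L (\<lambda>\<theta>. nrm (\<eta> \<theta>) * w \<theta>)"
    "(LINT \<theta>|?L. nrm (\<eta> \<theta>) * w \<theta>) \<le> ?N * (LINT \<theta>|?L. wq \<theta>) powr (1 / q)"
    using Holder_integral_nonneg[OF p q_gt_1 conj, of "\<lambda>\<theta>. nrm (\<eta> \<theta>)" w ?L] LpD(2)[OF \<eta>] wq w0
    by (simp_all add: Lp_norm_def w_eq)
  have N: "(LINT \<theta>|?L. nrm (\<eta> \<theta>) powr ?p) = ?N powr \<alpha> * ?N"
    using alpha by (simp add: Lp_norm_def powr_powr flip: powr_add) (simp add: field_simps)
  have h3: "integrable ?L (\<lambda>\<theta>. \<epsilon> * (nrm (\<eta> \<theta>) * 1) + K * nrm (\<eta> \<theta>) powr ?p + nrm (\<eta> \<theta>) * w \<theta>)"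
    using h1(1) h2(1) LpD(2)[OF \<eta>] by (intro Bochner_Integration.integrable_add integrable_mult_right)
  have le: "nrm (taylor_remainder (\<phi> \<theta>) (\<eta> \<theta>))
      \<le> \<epsilon> * (nrm (\<eta> \<theta>) * 1) + K * nrm (\<eta> \<theta>) powr ?p + nrm (\<eta> \<theta>) * w \<theta>" for \<theta>
    using remainder[of "\<phi> \<theta>" "\<eta> \<theta>"]
    by (simp add: w_def powr_add algebra_simps split: if_splits)
  show i: "integrable ?L (\<lambda>\<theta>. taylor_remainder (\<phi> \<theta>) (\<eta> \<theta>))"
    by (rule integrable_nrm_bound[OF _ h3 le]) measurable
  have "(LINT \<theta>|?L. nrm (taylor_remainder (\<phi> \<theta>) (\<eta> \<theta>)))
      \<le> (LINT \<theta>|?L. \<epsilon> * (nrm (\<eta> \<theta>) * 1) + K * nrm (\<eta> \<theta>) powr ?p + nrm (\<eta> \<theta>) * w \<theta>)"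
    by (intro integral_mono nrm_integral_le(1)[OF i] h3 le)
  also have "\<dots> = \<epsilon> * (LINT \<theta>|?L. nrm (\<eta> \<theta>) * 1) + K * (?N powr \<alpha> * ?N) + (LINT \<theta>|?L. nrm (\<eta> \<theta>) * w \<theta>)"
    unfolding N[symmetric] using h1(1) h2(1) LpD(2)[OF \<eta>] by simp
  also have "\<dots> \<le> \<epsilon> * (?N * V) + K * (?N powr \<alpha> * ?N) + ?N * (LINT \<theta>|?L. wq \<theta>) powr (1 / q)"
    using h1(2) h2(2) const by (intro add_mono mult_left_mono) auto
  also have "\<dots> = (\<epsilon> * V + K * ?N powr \<alpha> + (LINT \<theta>|?L. wq \<theta>) powr (1 / q)) * ?N"
    by (simp add: algebra_simps)
  finally show "(LINT \<theta>|?L. nrm (taylor_remainder (\<phi> \<theta>) (\<eta> \<theta>)))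
      \<le> (\<epsilon> * (LINT \<theta>|?L. 1) powr (1 / q) + K * ?N powr \<alpha>
         + (LINT \<theta>|?L. (if M < nrm (\<phi> \<theta>) then C powr q * nrm (\<phi> \<theta>) powr ?p else 0)) powr (1 / q)) * ?N"
    unfolding V_def wq_def .
qed

lemma taylor_remainder_integrable:
  assumes "\<phi> \<in> Lp nrm (\<alpha> + 1) a b" "\<eta> \<in> Lp nrm (\<alpha> + 1) a b"
  shows "integrable (lebesgue_on {a..b}) (\<lambda>\<theta>. taylor_remainder (\<phi> \<theta>) (\<eta> \<theta>))"
proof -
  obtain C where "0 \<le> C"
    "\<And>\<epsilon> M. 0 < \<epsilon> \<Longrightarrow> 1 \<le> M \<Longrightarrow> \<exists>K\<ge>0. \<forall>x h. nrm (taylor_remainder x h)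
       \<le> (\<epsilon> + K * nrm h powr \<alpha> + (if M < nrm x then C * nrm x powr \<alpha> else 0)) * nrm h"
    using taylor_remainder_le by blast
  moreover from this(2)[of 1 1] obtain K where "0 \<le> K" "\<And>x h. nrm (taylor_remainder x h)
       \<le> (1 + K * nrm h powr \<alpha> + (if 1 < nrm x then C * nrm x powr \<alpha> else 0)) * nrm h"
    by auto
  ultimately show ?thesis
    using taylor_remainder_integral_le(1)[OF assms zero_le_one] by blast
qed

lemma zero_mem_Lp: "(\<lambda>_. 0) \<in> Lp nrm p a b"
  by (simp add: Lp_def)

lemma Df_mult_integrable:
  assumes "\<phi> \<in> Lp nrm (\<alpha> + 1) a b" "\<eta> \<in> Lp nrm (\<alpha> + 1) a b"
  shows "integrable (lebesgue_on {a..b}) (\<lambda>\<theta>. Df f (\<phi> \<theta>) *v \<eta> \<theta>)"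
  using alpha by (intro matrix_Holder(1)[OF _ q_gt_1 conj assms(2) Df_comp_measurable[OF assms(1)] Df_comp_Lq[OF assms(1)]]) simp

text \<open>Expanded around the zero function, remainder included, \<open>f \<circ> \<eta>\<close> is a sum of integrable
  functions.\<close>
lemma f_comp_integrable:
  assumes \<eta>: "\<eta> \<in> Lp nrm (\<alpha> + 1) a b"
  shows "integrable (lebesgue_on {a..b}) (\<lambda>\<theta>. f (\<eta> \<theta>))"
proof -
  have "integrable (lebesgue_on {a..b}) (\<lambda>\<theta>. taylor_remainder 0 (\<eta> \<theta>) + f 0 + Df f 0 *v \<eta> \<theta>)"
    by (intro Bochner_Integration.integrable_add continuous_imp_integrable_real continuous_on_const
        taylor_remainder_integrable[OF zero_mem_Lp \<eta>] Df_mult_integrable[OF zero_mem_Lp \<eta>])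
  then show ?thesis by (simp add: taylor_remainder_def)
qed

text \<open>Each of the three terms is made at most a third of \<open>\<epsilon>\<close>: the first by the choice of \<open>\<epsilon>'\<close>, the
  tail by a large truncation level \<open>n\<close>, and the middle one by \<open>\<delta>\<close>, chosen after \<open>K\<close>.\<close>
lemma taylor_remainder_integral_small:
  assumes \<phi>: "\<phi> \<in> Lp nrm (\<alpha> + 1) a b" and \<epsilon>: "0 < \<epsilon>"
  obtains \<delta> where "0 < \<delta>"
    "\<And>\<eta>. \<eta> \<in> Lp nrm (\<alpha> + 1) a b \<Longrightarrow> Lp_norm nrm (\<alpha> + 1) a b \<eta> < \<delta> \<Longrightarrow>
       (LINT \<theta>|lebesgue_on {a..b}. nrm (taylor_remainder (\<phi> \<theta>) (\<eta> \<theta>)))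
         \<le> \<epsilon> * Lp_norm nrm (\<alpha> + 1) a b \<eta>"
proof -
  let ?L = "lebesgue_on {a..b}" and ?p = "\<alpha> + 1"
  define V where "V = (LINT \<theta>|?L. 1) powr (1 / q)"
  have V0: "0 \<le> V" by (simp add: V_def)
  obtain C where C: "0 \<le> C"
    "\<And>\<epsilon> M. 0 < \<epsilon> \<Longrightarrow> 1 \<le> M \<Longrightarrow> \<exists>K\<ge>0. \<forall>x h. nrm (taylor_remainder x h)
       \<le> (\<epsilon> + K * nrm h powr \<alpha> + (if M < nrm x then C * nrm x powr \<alpha> else 0)) * nrm h"
    using taylor_remainder_le by blast
  note [measurable] = LpD(1)[OF \<phi>]
  define J where "J n = (LINT \<theta>|?L. (if real n < nrm (\<phi> \<theta>) then C powr q * nrm (\<phi> \<theta>) powr ?p else 0))" for n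
  have "J \<longlonglongrightarrow> 0"
    unfolding J_def using LpD(2)[OF \<phi>] by (intro truncated_tail_tendsto_0) auto
  then have "\<forall>\<^sub>F n in sequentially. J n < (\<epsilon> / 3) powr q"
    using \<epsilon> by (intro order_tendstoD) auto
  then have "\<forall>\<^sub>F n in sequentially. J n < (\<epsilon> / 3) powr q \<and> 1 \<le> n"
    using eventually_ge_at_top[of 1] by eventually_elim simp
  then obtain n where n: "J n < (\<epsilon> / 3) powr q" "1 \<le> n"
    by (auto simp: eventually_sequentially)
  have J0: "0 \<le> J n"
    unfolding J_def using C by (intro Bochner_Integration.integral_nonneg) auto
  have "J n powr (1 / q) \<le> ((\<epsilon> / 3) powr q) powr (1 / q)"
    using n J0 q_gt_1 by (intro powr_mono2) auto
  then have Jn: "J n powr (1 / q) \<le> \<epsilon> / 3"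
    using \<epsilon> q_gt_1 by (simp add: powr_powr)
  \<comment> \<open>The summand 1 avoids a division by zero on an interval of length zero.\<close>
  define \<epsilon>' where "\<epsilon>' = \<epsilon> / (3 * (V + 1))"
  have \<epsilon>': "0 < \<epsilon>'" "\<epsilon>' * V \<le> \<epsilon> / 3"
    using \<epsilon> V0 by (auto simp: \<epsilon>'_def field_simps)
  obtain K where K: "0 \<le> K" "\<And>x h. nrm (taylor_remainder x h)
       \<le> (\<epsilon>' + K * nrm h powr \<alpha> + (if real n < nrm x then C * nrm x powr \<alpha> else 0)) * nrm h"
    using C(2)[OF \<epsilon>'(1), of "real n"] n(2) by auto
  show ?thesis
  proof
    let ?d = "(\<epsilon> / (3 * (K + 1))) powr (1 / \<alpha>)"
    show "0 < ?d" using \<epsilon> K by simp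
    fix \<eta> assume \<eta>: "\<eta> \<in> Lp nrm ?p a b" and small: "Lp_norm nrm ?p a b \<eta> < ?d"
    have "Lp_norm nrm ?p a b \<eta> powr \<alpha> \<le> ?d powr \<alpha>"
      using small alpha by (intro powr_mono2) auto
    also have "\<dots> = \<epsilon> / (3 * (K + 1))" using alpha \<epsilon> K by (simp add: powr_powr)
    finally have "K * Lp_norm nrm ?p a b \<eta> powr \<alpha> \<le> K * (\<epsilon> / (3 * (K + 1)))"
      using K(1) by (rule mult_left_mono)
    also have "\<dots> \<le> \<epsilon> / 3" using K \<epsilon> by (simp add: field_simps)
    finally have "\<epsilon>' * V + K * Lp_norm nrm ?p a b \<eta> powr \<alpha> + J n powr (1 / q) \<le> \<epsilon>"
      using \<epsilon>'(2) Jn by simp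
    then show "(LINT \<theta>|?L. nrm (taylor_remainder (\<phi> \<theta>) (\<eta> \<theta>))) \<le> \<epsilon> * Lp_norm nrm ?p a b \<eta>"
      using taylor_remainder_integral_le(2)[OF \<phi> \<eta> order_less_imp_le[OF \<epsilon>'(1)] K(1) C(1) K(2)]
        mult_right_mono[OF _ Lp_norm_nonneg] order_trans
      unfolding J_def V_def by blast
  qed
qed

end

section \<open>Existence and uniqueness of solutions\<close>

lemma ex_multiple_ge:
  fixes r t :: real
  assumes "0 < r"
  shows "\<exists>n. t \<le> real n * r"
  using reals_Archimedean3[OF assms] order_less_imp_le by blast

text \<open>Every solution is a fixed point of this operator on \<open>[-R,\<infinity>)\<close>; conversely, a fixed point
  has the regularity demanded of a solution once \<open>f \<circ> \<phi>\<close> is integrable.\<close>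
definition picard_step ::
    "(real ^ 'n \<Rightarrow> real ^ 'n) \<Rightarrow> (real \<Rightarrow> real ^ 'n) \<Rightarrow> real \<Rightarrow> (real \<Rightarrow> real ^ 'n) \<Rightarrow> real \<Rightarrow> real ^ 'n" where
  "picard_step f \<phi> r x t =
     (if t \<le> 0 then \<phi> t else \<phi> 0 + (LINT s|lebesgue_on {0..t}. f (x (s - r))))"

lemma picard_step_nonneg:
  "0 \<le> t \<Longrightarrow> picard_step f \<phi> r x t = \<phi> 0 + (LINT s|lebesgue_on {0..t}. f (x (s - r)))"
  using integral_lebesgue_on_degenerate[of 0 "\<lambda>s. f (x (s - r))"] by (auto simp: picard_step_def)

text \<open>The method of steps: because of the delay, the values up to time \<open>b\<close> determine the values of
  the image up to time \<open>b + r\<close>. Uniqueness and existence of fixed points both rest on this.\<close>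
lemma picard_step_delay_cong:
  assumes "r \<le> R" and "\<And>t. t \<in> {-R..b} \<Longrightarrow> x t = x' t" and "t \<in> {-R..b + r}"
  shows "picard_step f \<phi> r x t = picard_step f \<phi> r x' t"
proof -
  have "(LINT s|lebesgue_on {0..t}. f (x (s - r))) = (LINT s|lebesgue_on {0..t}. f (x' (s - r)))"
    using assms by (intro Bochner_Integration.integral_cong) auto
  then show ?thesis by (simp add: picard_step_def)
qed

lemma is_solution_picard_step:
  assumes "is_solution R f \<phi> r x" "-R \<le> t"
  shows "x t = picard_step f \<phi> r x t"
  using assms by (auto simp: is_solution_def picard_step_def)

lemma picard_step_fixpoint_unique:
  assumes r: "0 < r" "r \<le> R"
    and x: "\<And>t. -R \<le> t \<Longrightarrow> x t = picard_step f \<phi> r x t"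
    and x': "\<And>t. -R \<le> t \<Longrightarrow> x' t = picard_step f \<phi> r x' t"
    and t: "-R \<le> t"
  shows "x t = x' t"
proof -
  have agree: "\<forall>t\<in>{-R..real n * r}. x t = x' t" for n
  proof (induction n)
    case 0
    show ?case using x x' by (auto simp: picard_step_def)
  next
    case (Suc n)
    show ?case
    proof
      fix t assume t: "t \<in> {-R..real (Suc n) * r}"
      then have "picard_step f \<phi> r x t = picard_step f \<phi> r x' t"
        using Suc by (intro picard_step_delay_cong[OF r(2), of "real n * r"]) (auto simp: algebra_simps)
      then show "x t = x' t" using t x x' by auto
    qed
  qed
  show ?thesis using agree ex_multiple_ge[OF r(1), of t] t by auto
qed

text \<open>The \<open>n\<close>-th iterate, started at \<open>\<phi>\<close>, no longer changes on \<open>[-R, n r]\<close>, so the iterates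
  converge by becoming stationary; the fixed point takes at time \<open>t\<close> the value of the first iterate
  known to be final there.\<close>
lemma picard_step_fixpoint_exists:
  assumes r: "0 < r" "r \<le> R"
  obtains x where "\<And>t. -R \<le> t \<Longrightarrow> x t = picard_step f \<phi> r x t"
proof -
  define X where "X n = (picard_step f \<phi> r ^^ n) \<phi>" for n
  have X_Suc: "X (Suc n) = picard_step f \<phi> r (X n)" for n by (simp add: X_def)
  have stable: "\<forall>t\<in>{-R..real n * r}. X (Suc n) t = X n t" for n
  proof (induction n)
    case 0
    show ?case by (simp add: X_def picard_step_def)
  next
    case (Suc n)
    show ?case
    proof
      fix t assume t: "t \<in> {-R..real (Suc n) * r}"
      show "X (Suc (Suc n)) t = X (Suc n) t"
        unfolding X_Suc[of "Suc n"] unfolding X_Suc[of n] using Suc t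
        by (intro picard_step_delay_cong[OF r(2), of "real n * r"]) (auto simp: X_Suc algebra_simps)
    qed
  qed
  have stable': "X m t = X n t" if "n \<le> m" "t \<in> {-R..real n * r}" for m n t
    using that(1)
  proof (induction m rule: dec_induct)
    case (step m)
    have "real n * r \<le> real m * r" using step r by simp
    then show ?case using step stable[of m] that(2) by auto
  qed simp
  define x where "x t = X (LEAST n. t \<le> real n * r) t" for t
  have xX: "x t = X n t" if t: "t \<in> {-R..real n * r}" for n t
  proof -
    let ?m = "LEAST n. t \<le> real n * r"
    have "t \<le> real ?m * r" using LeastI_ex[OF ex_multiple_ge[OF r(1)]] .
    moreover have "?m \<le> n" using t by (intro Least_le) auto
    ultimately show ?thesis using stable'[of ?m n t] t by (simp add: x_def)
  qed
  show ?thesis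
  proof
    fix t assume t: "-R \<le> t"
    obtain n where n: "t \<le> real n * r" using ex_multiple_ge[OF r(1)] by blast
    have "t \<le> real n * r + r" using n r by simp
    have "x t = X (Suc n) t" using t n r by (intro xX) (auto simp: algebra_simps)
    also have "\<dots> = picard_step f \<phi> r (X n) t" by (simp add: X_Suc)
    also have "\<dots> = picard_step f \<phi> r x t"
      using t n r by (intro picard_step_delay_cong[OF r(2), of "real n * r"]) (auto simp: xX)
    finally show "x t = picard_step f \<phi> r x t" .
  qed
qed

text \<open>Integrability of \<open>f \<circ> x\<close> and continuity of \<open>x\<close> advance alternately by one delay: integrability
  up to \<open>n r\<close> makes \<open>x\<close> an indefinite integral, hence continuous, up to \<open>(n + 1) r\<close>, and then
  \<open>f \<circ> x\<close> is integrable there. Only the initial history contributes a possibly discontinuous part.\<close>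
lemma picard_step_fixpoint_regular:
  fixes f :: "real ^ 'n \<Rightarrow> real ^ 'n"
  assumes r: "0 < r" "r \<le> R" and f: "continuous_on UNIV f"
    and \<phi>: "integrable (lebesgue_on {-R..0}) (\<lambda>\<theta>. f (\<phi> \<theta>))"
    and x: "\<And>t. -R \<le> t \<Longrightarrow> x t = picard_step f \<phi> r x t"
  shows "integrable (lebesgue_on {0..real (Suc n) * r}) (\<lambda>s. f (x (s - r)))"
    and "continuous_on {0..real (Suc n) * r} x"
proof -
  have delayed: "integrable (lebesgue_on {0..real (Suc n) * r}) (\<lambda>s. f (x (s - r)))"
    if "integrable (lebesgue_on {-R..real n * r}) (\<lambda>s. f (x s))" for n
  proof -
    have "integrable (lebesgue_on {-R + r..real n * r + r}) (\<lambda>s. f (x (s - r)))"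
      using that by (rule integrable_shift)
    then show ?thesis
      by (rule integrable_subinterval) (use r in \<open>auto simp: algebra_simps\<close>)
  qed
  have cont: "continuous_on {0..real (Suc n) * r} x"
    if "integrable (lebesgue_on {-R..real n * r}) (\<lambda>s. f (x s))" for n
  proof -
    have "continuous_on {0..real (Suc n) * r} (\<lambda>t. \<phi> 0 + (LINT s|lebesgue_on {0..t}. f (x (s - r))))"
      by (intro continuous_on_add continuous_on_const indefinite_integral_continuous_real delayed that)
    moreover have "\<phi> 0 + (LINT s|lebesgue_on {0..t}. f (x (s - r))) = x t"
      if "t \<in> {0..real (Suc n) * r}" for t
      using x[of t] r that by (simp add: picard_step_nonneg)
    ultimately show ?thesis by (rule continuous_on_eq)
  qed
  have int: "integrable (lebesgue_on {-R..real n * r}) (\<lambda>s. f (x s))" for n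
  proof (induction n)
    case 0
    have "integrable (lebesgue_on {-R..0}) (\<lambda>s. f (x s)) \<longleftrightarrow> integrable (lebesgue_on {-R..0}) (\<lambda>s. f (\<phi> s))"
      by (intro Bochner_Integration.integrable_cong) (auto simp: x picard_step_def)
    then show ?case using \<phi> by simp
  next
    case (Suc n)
    have right: "integrable (lebesgue_on {0..real (Suc n) * r}) (\<lambda>s. f (x s))"
      by (intro continuous_imp_integrable_real continuous_on_compose2[OF f cont[OF Suc]]) auto
    have left: "integrable (lebesgue_on {-R..0}) (\<lambda>s. f (x s))"
      using Suc by (rule integrable_subinterval) (use r in auto)
    show ?case
      by (rule integrable_lebesgue_on_Icc_combine[OF left right]) (use r in auto)
  qed
  show "integrable (lebesgue_on {0..real (Suc n) * r}) (\<lambda>s. f (x (s - r)))"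
    by (rule delayed[OF int])
  show "continuous_on {0..real (Suc n) * r} x" by (rule cont[OF int])
qed

text \<open>The definite description that defines the solution is meaningful: the fixed point is unique
  on \<open>[-R,\<infinity>)\<close>, and its restriction to that set is the only representative that is extensional.\<close>
lemma solution_is_solution:
  fixes f :: "real ^ 'n \<Rightarrow> real ^ 'n"
  assumes r: "0 < r" "r \<le> R" and f: "continuous_on UNIV f"
    and \<phi>: "integrable (lebesgue_on {-R..0}) (\<lambda>\<theta>. f (\<phi> \<theta>))"
  shows "is_solution R f \<phi> r (solution R f \<phi> r)"
proof -
  obtain x0 where x0: "\<And>t. -R \<le> t \<Longrightarrow> x0 t = picard_step f \<phi> r x0 t"
    using picard_step_fixpoint_exists[OF r] by metis
  define x where "x = restrict x0 {-R..}"
  have x: "x t = picard_step f \<phi> r x t" if t: "-R \<le> t" for t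
  proof -
    have "x t = picard_step f \<phi> r x0 t" using t x0 by (simp add: x_def)
    also have "\<dots> = picard_step f \<phi> r x t"
      using t r by (intro picard_step_delay_cong[OF r(2), of t]) (auto simp: x_def)
    finally show ?thesis .
  qed
  have reg: "integrable (lebesgue_on {0..real (Suc n) * r}) (\<lambda>s. f (x (s - r)))"
    "continuous_on {0..real (Suc n) * r} x" for n
    by (rule picard_step_fixpoint_regular[OF r f \<phi>]; rule x; assumption)+
  have sol: "is_solution R f \<phi> r x"
    unfolding is_solution_def
  proof (intro conjI ballI allI impI)
    show "x t = \<phi> t" if "t \<in> {-R..0}" for t
      using x[of t] that by (simp add: picard_step_def)
    show "continuous_on {0..} x"
      unfolding continuous_on_eq_continuous_within
    proof
      fix t :: real assume t: "t \<in> {0..}"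
      obtain n where n: "t \<le> real n * r" using ex_multiple_ge[OF r(1)] by blast
      then have lt: "t < real (Suc n) * r" using r by (simp add: algebra_simps)
      then have "continuous (at t within {0..real (Suc n) * r}) x"
        using reg(2)[of n] t by (auto simp: continuous_on_eq_continuous_within)
      moreover have "at t within {0..real (Suc n) * r} = at t within {0..}"
        by (rule at_within_nhd[of _ "{..<real (Suc n) * r}"]) (use lt in auto)
      ultimately show "continuous (at t within {0..}) x" by simp
    qed
    fix t :: real assume t: "0 \<le> t"
    obtain n where n: "t \<le> real n * r" using ex_multiple_ge[OF r(1)] by blast
    then have "{0..t} \<subseteq> {0..real (Suc n) * r}" using r by (auto simp: algebra_simps)
    then show "integrable (lebesgue_on {0..t}) (\<lambda>s. f (x (s - r)))"
      by (rule integrable_subinterval[OF reg(1)])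
    show "x t = \<phi> 0 + (LINT s|lebesgue_on {0..t}. f (x (s - r)))"
      using x[of t] r t by (simp add: picard_step_nonneg)
  qed
  have "x' = x" if x': "x' \<in> extensional {-R..}" "is_solution R f \<phi> r x'" for x'
  proof
    fix t show "x' t = x t"
    proof (cases "-R \<le> t")
      case True
      then show ?thesis
        using picard_step_fixpoint_unique[OF r is_solution_picard_step[OF x'(2)] x] by blast
    next
      case False
      then show ?thesis using x'(1) by (simp add: x_def extensional_def)
    qed
  qed
  moreover have "x \<in> extensional {-R..}" by (simp add: x_def)
  ultimately have "solution R f \<phi> r = x"
    unfolding solution_def using sol by (intro the_equality) blast+
  then show ?thesis using sol by simp
qed

lemma y_part_eq:
  fixes f :: "real ^ 'n \<Rightarrow> real ^ 'n"
  assumes r: "0 < r" "r \<le> R" and f: "continuous_on UNIV f"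
    and \<phi>: "integrable (lebesgue_on {-R..0}) (\<lambda>\<theta>. f (\<phi> \<theta>))"
  shows "-R \<le> t \<Longrightarrow> t \<le> 0 \<Longrightarrow> y_part R f \<phi> r t = 0"
    and "0 < t \<Longrightarrow> t \<le> r \<Longrightarrow> y_part R f \<phi> r t = (LINT s|lebesgue_on {0..t}. f (\<phi> (s - r)))"
proof -
  let ?x = "solution R f \<phi> r"
  note sol = solution_is_solution[OF r f \<phi>, unfolded is_solution_def]
  show "-R \<le> t \<Longrightarrow> t \<le> 0 \<Longrightarrow> y_part R f \<phi> r t = 0"
    using sol by (simp add: y_part_def prolongation_def)
  assume t: "0 < t" "t \<le> r"
  have "(LINT s|lebesgue_on {0..t}. f (?x (s - r))) = (LINT s|lebesgue_on {0..t}. f (\<phi> (s - r)))"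
    using sol t r by (intro Bochner_Integration.integral_cong) auto
  moreover have "?x t = \<phi> 0 + (LINT s|lebesgue_on {0..t}. f (?x (s - r)))"
    using sol t by simp
  ultimately show "y_part R f \<phi> r t = (LINT s|lebesgue_on {0..t}. f (\<phi> (s - r)))"
    using t by (simp add: y_part_def prolongation_def)
qed

section \<open>The derivative of the solution with respect to the history\<close>

lemma C_norm_le:
  assumes "c \<le> d" "\<And>t. t \<in> {c..d} \<Longrightarrow> nrm (g t) \<le> B"
  shows "C_norm nrm c d g \<le> B"
  unfolding C_norm_def using assms by (intro cSUP_least) auto

context C1_power_growth begin

context
  fixes R r T :: real
  assumes delay: "0 < T" "T \<le> r" "r \<le> R"
begin

abbreviation "LpR \<equiv> Lp nrm (\<alpha> + 1) (-R) 0"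
abbreviation "LpR_norm \<equiv> Lp_norm nrm (\<alpha> + 1) (-R) 0"

lemma B_op_integrable:
  assumes "\<phi> \<in> LpR" "\<eta> \<in> LpR" "0 \<le> t" "t \<le> T"
  shows "integrable (lebesgue_on {0..t}) (\<lambda>s. Df f (\<phi> (s - r)) *v \<eta> (s - r))"
  using delayed_integral(1)[OF Df_mult_integrable[OF assms(1,2)], of t r] assms delay by simp

lemma B_op_diff_le:
  assumes \<phi>: "\<phi> \<in> LpR" and \<psi>: "\<psi> \<in> LpR" and \<eta>: "\<eta> \<in> LpR"
  shows "C_norm nrm (-R) T (\<lambda>t. B_op f \<phi> r \<eta> t - B_op f \<psi> r \<eta> t)
    \<le> Lp_norm (mat_norm nrm) q (-R) 0 (\<lambda>\<theta>. Df f (\<phi> \<theta>) - Df f (\<psi> \<theta>)) * LpR_norm \<eta>"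
    (is "_ \<le> ?C")
proof (rule C_norm_le)
  show "-R \<le> T" using delay by simp
  fix t assume t: "t \<in> {-R..T}"
  show "nrm (B_op f \<phi> r \<eta> t - B_op f \<psi> r \<eta> t) \<le> ?C"
  proof (cases "t \<le> 0")
    case False
    let ?A = "\<lambda>\<theta>. Df f (\<phi> \<theta>) - Df f (\<psi> \<theta>)"
    have A: "?A \<in> borel_measurable (lebesgue_on {-R..0})"
      using Df_comp_measurable[OF \<phi>] Df_comp_measurable[OF \<psi>] by (rule borel_measurable_diff)
    have p: "1 < \<alpha> + 1" using alpha by simp
    note H = matrix_Holder[OF p q_gt_1 conj \<eta> A Df_diff_comp_Lq[OF \<phi> \<psi>]]
    have "B_op f \<phi> r \<eta> t - B_op f \<psi> r \<eta> t = (LINT s|lebesgue_on {0..t}. ?A (s - r) *v \<eta> (s - r))"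
      using False B_op_integrable[OF \<phi> \<eta>] B_op_integrable[OF \<psi> \<eta>] t
      by (simp add: B_op_def matrix_vector_mult_diff_rdistrib)
    also have "nrm \<dots> \<le> (LINT \<theta>|lebesgue_on {-R..0}. nrm (?A \<theta> *v \<eta> \<theta>))"
      using False t delay by (intro delayed_integral(2)[OF H(1)]) auto
    also have "\<dots> \<le> ?C" by (rule H(2))
    finally show ?thesis .
  qed (simp add: B_op_def)
qed

lemma B_op_bounded:
  assumes \<phi>: "\<phi> \<in> LpR" and \<eta>: "\<eta> \<in> LpR"
  shows "C_norm nrm (-R) T (B_op f \<phi> r \<eta>)
    \<le> Lp_norm (mat_norm nrm) q (-R) 0 (\<lambda>\<theta>. Df f (\<phi> \<theta>)) * LpR_norm \<eta>"
    (is "_ \<le> ?C")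
proof (rule C_norm_le)
  show "-R \<le> T" using delay by simp
  fix t assume t: "t \<in> {-R..T}"
  show "nrm (B_op f \<phi> r \<eta> t) \<le> ?C"
  proof (cases "t \<le> 0")
    case False
    have p: "1 < \<alpha> + 1" using alpha by simp
    note H = matrix_Holder[OF p q_gt_1 conj \<eta> Df_comp_measurable[OF \<phi>] Df_comp_Lq[OF \<phi>]]
    have "nrm (B_op f \<phi> r \<eta> t) \<le> (LINT \<theta>|lebesgue_on {-R..0}. nrm (Df f (\<phi> \<theta>) *v \<eta> \<theta>))"
      using False t delay delayed_integral(2)[OF H(1), of t r] by (simp add: B_op_def)
    also have "\<dots> \<le> ?C" by (rule H(2))
    finally show ?thesis .
  qed (simp add: B_op_def)
qed

lemma continuous_on_B_op:
  assumes \<phi>: "\<phi> \<in> LpR" and \<eta>: "\<eta> \<in> LpR"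
  shows "continuous_on {-R..T} (B_op f \<phi> r \<eta>)"
proof -
  let ?g = "\<lambda>s. Df f (\<phi> (s - r)) *v \<eta> (s - r)"
  have "continuous_on ({-R..0} \<union> {0..T}) (\<lambda>t. if t \<le> 0 then 0 else LINT s|lebesgue_on {0..t}. ?g s)"
  proof (rule continuous_on_cases)
    show "continuous_on {0..T} (\<lambda>t. LINT s|lebesgue_on {0..t}. ?g s)"
      using B_op_integrable[OF \<phi> \<eta>, of T] delay by (intro indefinite_integral_continuous_real) simp
    show "\<forall>t. t \<in> {-R..0} \<and> \<not> t \<le> 0 \<or> t \<in> {0..T} \<and> t \<le> 0 \<longrightarrow>
        0 = (LINT s|lebesgue_on {0..t}. ?g s)"
      using integral_lebesgue_on_degenerate[of 0 ?g] by (auto simp: antisym_conv)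
  qed auto
  moreover have "{-R..0} \<union> {0..T} = {-R..T}" using delay by auto
  ultimately show ?thesis by (simp add: B_op_def[abs_def])
qed

lemma bounded_linear_B_op:
  assumes \<phi>: "\<phi> \<in> LpR"
  shows "bounded_linear_Lp_C nrm (\<alpha> + 1) (-R) 0 (-R) T (B_op f \<phi> r)"
  unfolding bounded_linear_Lp_C_def
proof (intro conjI ballI allI)
  show "continuous_on {-R..T} (B_op f \<phi> r \<eta>)" if "\<eta> \<in> LpR" for \<eta>
    by (rule continuous_on_B_op[OF \<phi> that])
  show "B_op f \<phi> r (\<lambda>\<theta>. \<eta> \<theta> + \<psi> \<theta>) t = B_op f \<phi> r \<eta> t + B_op f \<phi> r \<psi> t"
    if "\<eta> \<in> LpR" "\<psi> \<in> LpR" "t \<in> {-R..T}" for \<eta> \<psi> t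
    using B_op_integrable[OF \<phi> that(1), of t] B_op_integrable[OF \<phi> that(2), of t] that(3)
    by (simp add: B_op_def matrix_vector_right_distrib)
  show "B_op f \<phi> r (\<lambda>\<theta>. k *\<^sub>R \<eta> \<theta>) t = k *\<^sub>R B_op f \<phi> r \<eta> t" for k \<eta> t
    by (simp add: B_op_def matrix_vector_mult_scaleR)
  show "bounded_map LpR LpR_norm (C_norm nrm (-R) T) (B_op f \<phi> r)"
    unfolding bounded_map_def using B_op_bounded[OF \<phi>] by blast
qed

text \<open>On \<open>[0,T]\<close> the two solutions and \<open>B_op\<close> are explicit integrals of delayed functions, and
  their combination is the delayed integral of the Taylor remainder.\<close>
lemma B_op_is_derivative:
  assumes \<phi>: "\<phi> \<in> LpR" and \<epsilon>: "0 < \<epsilon>"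
  shows "\<exists>\<delta>>0. \<forall>\<eta>\<in>LpR. LpR_norm \<eta> < \<delta> \<longrightarrow>
    C_norm nrm (-R) T
      (\<lambda>t. y_part R f (\<lambda>\<theta>. \<phi> \<theta> + \<eta> \<theta>) r t - y_part R f \<phi> r t - B_op f \<phi> r \<eta> t)
    \<le> \<epsilon> * LpR_norm \<eta>"
proof -
  obtain \<delta> where \<delta>: "0 < \<delta>"
    "\<And>\<eta>. \<eta> \<in> LpR \<Longrightarrow> LpR_norm \<eta> < \<delta> \<Longrightarrow>
       (LINT \<theta>|lebesgue_on {-R..0}. nrm (taylor_remainder (\<phi> \<theta>) (\<eta> \<theta>))) \<le> \<epsilon> * LpR_norm \<eta>"
    using taylor_remainder_integral_small[OF \<phi> \<epsilon>] by blast
  have "C_norm nrm (-R) T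
      (\<lambda>t. y_part R f (\<lambda>\<theta>. \<phi> \<theta> + \<eta> \<theta>) r t - y_part R f \<phi> r t - B_op f \<phi> r \<eta> t)
    \<le> \<epsilon> * LpR_norm \<eta>" if \<eta>: "\<eta> \<in> LpR" and small: "LpR_norm \<eta> < \<delta>" for \<eta>
  proof (rule C_norm_le)
    show "-R \<le> T" using delay by simp
    fix t assume t: "t \<in> {-R..T}"
    have \<phi>\<eta>: "(\<lambda>\<theta>. \<phi> \<theta> + \<eta> \<theta>) \<in> LpR" using alpha by (intro Lp_add \<phi> \<eta>) simp
    have r: "0 < r" using delay by simp
    note y = y_part_eq[OF r delay(3) continuous_on_f f_comp_integrable[OF \<phi>], of t]
      y_part_eq[OF r delay(3) continuous_on_f f_comp_integrable[OF \<phi>\<eta>], of t]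
    show "nrm (y_part R f (\<lambda>\<theta>. \<phi> \<theta> + \<eta> \<theta>) r t - y_part R f \<phi> r t - B_op f \<phi> r \<eta> t)
        \<le> \<epsilon> * LpR_norm \<eta>"
    proof (cases "t \<le> 0")
      case True
      then show ?thesis using y(1,3) t \<epsilon> by (simp add: B_op_def)
    next
      case False
      then have t': "0 < t" "0 \<le> t" "t \<le> T" "t \<le> r" using t delay by auto
      note int = delayed_integral(1)[OF f_comp_integrable[OF \<phi>\<eta>] t'(2,4) delay(3)]
        delayed_integral(1)[OF f_comp_integrable[OF \<phi>] t'(2,4) delay(3)]
        B_op_integrable[OF \<phi> \<eta> t'(2,3)]
      have "y_part R f (\<lambda>\<theta>. \<phi> \<theta> + \<eta> \<theta>) r t - y_part R f \<phi> r t - B_op f \<phi> r \<eta> t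
          = (LINT s|lebesgue_on {0..t}. taylor_remainder (\<phi> (s - r)) (\<eta> (s - r)))"
        using y(2,4) t' int by (simp add: B_op_def taylor_remainder_def)
      also have "nrm \<dots> \<le> (LINT \<theta>|lebesgue_on {-R..0}. nrm (taylor_remainder (\<phi> \<theta>) (\<eta> \<theta>)))"
        by (rule delayed_integral(2)[OF taylor_remainder_integrable[OF \<phi> \<eta>] t'(2,4) delay(3)])
      also have "\<dots> \<le> \<epsilon> * LpR_norm \<eta>" by (rule \<delta>(2)[OF \<eta> small])
      finally show ?thesis .
    qed
  qed
  then show ?thesis using \<delta>(1) by blast
qed

end

end

theorem theorem3p7:
  fixes nrm :: "real ^ 'n \<Rightarrow> real"
    and f :: "real ^ 'n \<Rightarrow> real ^ 'n"
    and R T \<alpha> q :: real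
  assumes "is_norm nrm"
    and "0 < R" and "0 < T" and "T < R"
    and "class_C1 f"
    and "\<alpha> \<ge> 1"
    and "\<exists>C>0. \<exists>K>0. \<forall>x. nrm x \<ge> K \<longrightarrow> mat_norm nrm (Df f x) \<le> C * nrm x powr \<alpha>"
    and "1 / (\<alpha> + 1) + 1 / q = 1"
  shows "(\<forall>\<phi>\<in>Lp nrm (\<alpha> + 1) (-R) 0. \<forall>r\<in>{T..R}.
            bounded_linear_Lp_C nrm (\<alpha> + 1) (-R) 0 (-R) T (B_op f \<phi> r)) \<and>
         (\<forall>\<phi>\<in>Lp nrm (\<alpha> + 1) (-R) 0. \<forall>\<phi>\<^sub>0\<in>Lp nrm (\<alpha> + 1) (-R) 0. \<forall>r\<in>{T..R}.
            op_norm (Lp nrm (\<alpha> + 1) (-R) 0) (Lp_norm nrm (\<alpha> + 1) (-R) 0) (C_norm nrm (-R) T)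
              (\<lambda>\<eta> t. B_op f \<phi> r \<eta> t - B_op f \<phi>\<^sub>0 r \<eta> t)
            \<le> Lp_norm (mat_norm nrm) q (-R) 0 (\<lambda>\<theta>. Df f (\<phi> \<theta>) - Df f (\<phi>\<^sub>0 \<theta>))) \<and>
         (\<forall>\<phi>\<in>Lp nrm (\<alpha> + 1) (-R) 0. \<forall>r\<in>{T..R}.
            \<forall>\<epsilon>>0. \<exists>\<delta>>0. \<forall>\<eta>\<in>Lp nrm (\<alpha> + 1) (-R) 0.
              Lp_norm nrm (\<alpha> + 1) (-R) 0 \<eta> < \<delta> \<longrightarrow>
              C_norm nrm (-R) T
                (\<lambda>t. y_part R f (\<lambda>\<theta>. \<phi> \<theta> + \<eta> \<theta>) r t - y_part R f \<phi> r t - B_op f \<phi> r \<eta> t)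
              \<le> \<epsilon> * Lp_norm nrm (\<alpha> + 1) (-R) 0 \<eta>)"
proof -
  interpret C1_power_growth nrm f \<alpha> q
    using assms by unfold_locales auto
  show ?thesis
  proof (intro conjI ballI allI impI)
    fix \<phi> r assume \<phi>: "\<phi> \<in> Lp nrm (\<alpha> + 1) (-R) 0" and r: "r \<in> {T..R}"
    then have delay: "0 < T" "T \<le> r" "r \<le> R" using assms(3) by auto
    show "bounded_linear_Lp_C nrm (\<alpha> + 1) (-R) 0 (-R) T (B_op f \<phi> r)"
      by (rule bounded_linear_B_op[OF delay \<phi>])
    show "op_norm (Lp nrm (\<alpha> + 1) (-R) 0) (Lp_norm nrm (\<alpha> + 1) (-R) 0) (C_norm nrm (-R) T)
              (\<lambda>\<eta> t. B_op f \<phi> r \<eta> t - B_op f \<phi>\<^sub>0 r \<eta> t)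
            \<le> Lp_norm (mat_norm nrm) q (-R) 0 (\<lambda>\<theta>. Df f (\<phi> \<theta>) - Df f (\<phi>\<^sub>0 \<theta>))"
      if "\<phi>\<^sub>0 \<in> Lp nrm (\<alpha> + 1) (-R) 0" for \<phi>\<^sub>0
      by (intro op_norm_le Lp_norm_nonneg B_op_diff_le[OF delay \<phi> that])
    show "\<exists>\<delta>>0. \<forall>\<eta>\<in>Lp nrm (\<alpha> + 1) (-R) 0.
              Lp_norm nrm (\<alpha> + 1) (-R) 0 \<eta> < \<delta> \<longrightarrow>
              C_norm nrm (-R) T
                (\<lambda>t. y_part R f (\<lambda>\<theta>. \<phi> \<theta> + \<eta> \<theta>) r t - y_part R f \<phi> r t - B_op f \<phi> r \<eta> t)
              \<le> \<epsilon> * Lp_norm nrm (\<alpha> + 1) (-R) 0 \<eta>" if "0 < \<epsilon>" for \<epsilon>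
      by (rule B_op_is_derivative[OF delay \<phi> that])
  qed
qed

end
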